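(* Let $X$ and $Y$ be compact $0$-dimensional Hausdorff spaces. Then the C*-algebras $C(X)$ and $C(Y)$ are elementarily equivalent (as metric structures) if and only if the Boolean algebras $CL(X)$ and $CL(Y)$ are elementarily equivalent (in classical first-order logic).
   Context: $C(X)$ is the C*-algebra of continuous complex-valued functions on $X$; $CL(X)$ is the Boolean algebra of clopen subsets of $X$; a space is $0$-dimensional if it has a basis of clopen sets. Elementary equivalence of C*-algebras is in continuous logic: formulas are built from norms $\|P(\bar x)\|$ of $*$-polynomials with complex coefficients (constant terms being allowed for unital algebras) by applying continuous real functions and taking $\sup$ and $\inf$ over variables ranging over the closed unit ball; a sentence is a formula without free variables; $A\equiv B$ if the same sentences have value $0$ in $A$ and in $B$. *)

theory Defs
  imports "HOL-Analysis.Analysis" "HOL-Algebra.Module"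
begin

section \<open>Spaces\<close>

definition zero_dimensional :: "'a topology \<Rightarrow> bool" where
  "zero_dimensional X \<longleftrightarrow>
     (\<exists>\<B>. (\<forall>U\<in>\<B>. openin X U \<and> closedin X U) \<and> openin X = arbitrary union_of (\<lambda>U. U \<in> \<B>))"


section \<open>The unital C*-algebra of continuous functions\<close>

text \<open>The operations of a unital C*-algebra: a complex module structure (with its ring
  multiplication and unit) together with an involution and a norm. The record fixes the signature
  only.\<close>

record 'a unital_star_algebra = "(complex, 'a) module" +
  star :: "'a \<Rightarrow> 'a"
  nrm :: "'a \<Rightarrow> real"

text \<open>Functions are made extensional (\<^const>\<open>undefined\<close> outside the space), so that equality of
  elements is equality of functions on the space. The empty space is allowed and yields the zero
  algebra; there the norm is set to 0 by hand, because the supremum of the empty set of reals is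
  unspecified.\<close>

definition C_algebra :: "'a topology \<Rightarrow> ('a \<Rightarrow> complex) unital_star_algebra" where
  "C_algebra X =
    \<lparr> carrier = {f. continuous_map X euclidean f \<and> f \<in> extensional (topspace X)},
      monoid.mult = (\<lambda>f g. \<lambda>x\<in>topspace X. f x * g x),
      one = (\<lambda>x\<in>topspace X. 1),
      zero = (\<lambda>x\<in>topspace X. 0),
      add = (\<lambda>f g. \<lambda>x\<in>topspace X. f x + g x),
      smult = (\<lambda>c f. \<lambda>x\<in>topspace X. c * f x),
      star = (\<lambda>f. \<lambda>x\<in>topspace X. cnj (f x)),
      nrm = (\<lambda>f. if topspace X = {} then 0 else (SUP x\<in>topspace X. cmod (f x))) \<rparr>"


section \<open>Continuous logic for unital C*-algebras\<close>

text \<open>*-polynomials with complex coefficients, in (noncommuting) variables indexed by natural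
  numbers. A constant \<open>c\<close> stands for \<open>c\<close> times the unit, so multiplying by it is multiplication
  by the scalar \<open>c\<close>.\<close>

datatype star_poly =
    PVar nat
  | PConst complex
  | PAdd star_poly star_poly
  | PMult star_poly star_poly
  | PStar star_poly

primrec poly_val :: "('a, 'm) unital_star_algebra_scheme \<Rightarrow> star_poly \<Rightarrow> (nat \<Rightarrow> 'a) \<Rightarrow> 'a" where
  "poly_val A (PVar n) \<sigma> = \<sigma> n"
| "poly_val A (PConst c) \<sigma> = c \<odot>\<^bsub>A\<^esub> \<one>\<^bsub>A\<^esub>"
| "poly_val A (PAdd p q) \<sigma> = poly_val A p \<sigma> \<oplus>\<^bsub>A\<^esub> poly_val A q \<sigma>"
| "poly_val A (PMult p q) \<sigma> = poly_val A p \<sigma> \<otimes>\<^bsub>A\<^esub> poly_val A q \<sigma>"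
| "poly_val A (PStar p) \<sigma> = star A (poly_val A p \<sigma>)"

primrec poly_vars :: "star_poly \<Rightarrow> nat set" where
  "poly_vars (PVar n) = {n}"
| "poly_vars (PConst c) = {}"
| "poly_vars (PAdd p q) = poly_vars p \<union> poly_vars q"
| "poly_vars (PMult p q) = poly_vars p \<union> poly_vars q"
| "poly_vars (PStar p) = poly_vars p"

text \<open>In \<open>CConn u \<phi>s\<close> the function \<open>u\<close> is a connective whose arity is the length \<open>k\<close> of the list
  \<open>\<phi>s\<close>. Points of \<open>k\<close>-dimensional real space are functions on \<open>{..<k}\<close>, and
  \<open>wf_cform\<close> demands that \<open>u\<close> is continuous there.\<close>

datatype cform =
    CNorm star_poly
  | CConn "(nat \<Rightarrow> real) \<Rightarrow> real" "cform list"
  | CSup nat cform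
  | CInf nat cform

primrec wf_cform :: "cform \<Rightarrow> bool" where
  "wf_cform (CNorm p) = True"
| "wf_cform (CConn u \<phi>s) =
     (continuous_map (powertop_real {..<length \<phi>s}) euclideanreal u \<and> list_all wf_cform \<phi>s)"
| "wf_cform (CSup n \<phi>) = wf_cform \<phi>"
| "wf_cform (CInf n \<phi>) = wf_cform \<phi>"

primrec cform_vars :: "cform \<Rightarrow> nat set" where
  "cform_vars (CNorm p) = poly_vars p"
| "cform_vars (CConn u \<phi>s) = \<Union> (set (map cform_vars \<phi>s))"
| "cform_vars (CSup n \<phi>) = cform_vars \<phi> - {n}"
| "cform_vars (CInf n \<phi>) = cform_vars \<phi> - {n}"

definition closed_unit_ball :: "('a, 'm) unital_star_algebra_scheme \<Rightarrow> 'a set" where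
  "closed_unit_ball A = {a \<in> carrier A. nrm A a \<le> 1}"

text \<open>In a C*-algebra, the values of a well-formed formula on assignments into the closed unit ball
  are bounded, so that the suprema and infima over the unit ball are genuine.\<close>

primrec cform_val :: "('a, 'm) unital_star_algebra_scheme \<Rightarrow> cform \<Rightarrow> (nat \<Rightarrow> 'a) \<Rightarrow> real" where
  "cform_val A (CNorm p) \<sigma> = nrm A (poly_val A p \<sigma>)"
| "cform_val A (CConn u \<phi>s) \<sigma> = u (\<lambda>i\<in>{..<length \<phi>s}. (map (cform_val A) \<phi>s ! i) \<sigma>)"
| "cform_val A (CSup n \<phi>) \<sigma> = (SUP a\<in>closed_unit_ball A. cform_val A \<phi> (\<sigma>(n := a)))"
| "cform_val A (CInf n \<phi>) \<sigma> = (INF a\<in>closed_unit_ball A. cform_val A \<phi> (\<sigma>(n := a)))"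

definition csentence :: "cform \<Rightarrow> bool" where
  "csentence \<phi> \<longleftrightarrow> wf_cform \<phi> \<and> cform_vars \<phi> = {}"

text \<open>The value of a sentence does not depend on the assignment; the zero assignment is used.\<close>

definition csentence_val :: "('a, 'm) unital_star_algebra_scheme \<Rightarrow> cform \<Rightarrow> real" where
  "csentence_val A \<phi> = cform_val A \<phi> (\<lambda>_. \<zero>\<^bsub>A\<^esub>)"

definition metric_elementarily_equivalent ::
  "('a, 'm) unital_star_algebra_scheme \<Rightarrow> ('b, 'n) unital_star_algebra_scheme \<Rightarrow> bool" where
  "metric_elementarily_equivalent A B \<longleftrightarrow>
     (\<forall>\<phi>. csentence \<phi> \<longrightarrow> (csentence_val A \<phi> = 0 \<longleftrightarrow> csentence_val B \<phi> = 0))"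


section \<open>The Boolean algebra of clopen sets\<close>

text \<open>As above, the record fixes the signature of Boolean algebras only.\<close>

record 'a bool_alg = "'a partial_object" +
  ba_bot :: 'a
  ba_top :: 'a
  ba_join :: "'a \<Rightarrow> 'a \<Rightarrow> 'a"
  ba_meet :: "'a \<Rightarrow> 'a \<Rightarrow> 'a"
  ba_compl :: "'a \<Rightarrow> 'a"

definition CL_algebra :: "'a topology \<Rightarrow> 'a set bool_alg" where
  "CL_algebra X =
    \<lparr> carrier = {U. openin X U \<and> closedin X U},
      ba_bot = {},
      ba_top = topspace X,
      ba_join = (\<union>),
      ba_meet = (\<inter>),
      ba_compl = (\<lambda>U. topspace X - U) \<rparr>"


section \<open>First-order logic for Boolean algebras\<close>

datatype ba_term =
    BVar nat
  | BBot
  | BTop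
  | BJoin ba_term ba_term
  | BMeet ba_term ba_term
  | BCompl ba_term

primrec term_val :: "('a, 'm) bool_alg_scheme \<Rightarrow> ba_term \<Rightarrow> (nat \<Rightarrow> 'a) \<Rightarrow> 'a" where
  "term_val B (BVar n) \<sigma> = \<sigma> n"
| "term_val B BBot \<sigma> = ba_bot B"
| "term_val B BTop \<sigma> = ba_top B"
| "term_val B (BJoin s t) \<sigma> = ba_join B (term_val B s \<sigma>) (term_val B t \<sigma>)"
| "term_val B (BMeet s t) \<sigma> = ba_meet B (term_val B s \<sigma>) (term_val B t \<sigma>)"
| "term_val B (BCompl t) \<sigma> = ba_compl B (term_val B t \<sigma>)"

primrec term_vars :: "ba_term \<Rightarrow> nat set" where
  "term_vars (BVar n) = {n}"
| "term_vars BBot = {}"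
| "term_vars BTop = {}"
| "term_vars (BJoin s t) = term_vars s \<union> term_vars t"
| "term_vars (BMeet s t) = term_vars s \<union> term_vars t"
| "term_vars (BCompl t) = term_vars t"

datatype fo_form =
    FEq ba_term ba_term
  | FNot fo_form
  | FAnd fo_form fo_form
  | FOr fo_form fo_form
  | FAll nat fo_form
  | FEx nat fo_form

primrec fo_sat :: "('a, 'm) bool_alg_scheme \<Rightarrow> fo_form \<Rightarrow> (nat \<Rightarrow> 'a) \<Rightarrow> bool" where
  "fo_sat B (FEq s t) \<sigma> \<longleftrightarrow> term_val B s \<sigma> = term_val B t \<sigma>"
| "fo_sat B (FNot \<phi>) \<sigma> \<longleftrightarrow> \<not> fo_sat B \<phi> \<sigma>"
| "fo_sat B (FAnd \<phi> \<psi>) \<sigma> \<longleftrightarrow> fo_sat B \<phi> \<sigma> \<and> fo_sat B \<psi> \<sigma>"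
| "fo_sat B (FOr \<phi> \<psi>) \<sigma> \<longleftrightarrow> fo_sat B \<phi> \<sigma> \<or> fo_sat B \<psi> \<sigma>"
| "fo_sat B (FAll n \<phi>) \<sigma> \<longleftrightarrow> (\<forall>a\<in>carrier B. fo_sat B \<phi> (\<sigma>(n := a)))"
| "fo_sat B (FEx n \<phi>) \<sigma> \<longleftrightarrow> (\<exists>a\<in>carrier B. fo_sat B \<phi> (\<sigma>(n := a)))"

primrec fo_vars :: "fo_form \<Rightarrow> nat set" where
  "fo_vars (FEq s t) = term_vars s \<union> term_vars t"
| "fo_vars (FNot \<phi>) = fo_vars \<phi>"
| "fo_vars (FAnd \<phi> \<psi>) = fo_vars \<phi> \<union> fo_vars \<psi>"
| "fo_vars (FOr \<phi> \<psi>) = fo_vars \<phi> \<union> fo_vars \<psi>"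
| "fo_vars (FAll n \<phi>) = fo_vars \<phi> - {n}"
| "fo_vars (FEx n \<phi>) = fo_vars \<phi> - {n}"

definition fo_sentence :: "fo_form \<Rightarrow> bool" where
  "fo_sentence \<phi> \<longleftrightarrow> fo_vars \<phi> = {}"

text \<open>Again, for sentences the assignment is irrelevant.\<close>

definition fo_models :: "('a, 'm) bool_alg_scheme \<Rightarrow> fo_form \<Rightarrow> bool" where
  "fo_models B \<phi> \<longleftrightarrow> fo_sat B \<phi> (\<lambda>_. ba_bot B)"

definition elementarily_equivalent ::
  "('a, 'm) bool_alg_scheme \<Rightarrow> ('b, 'n) bool_alg_scheme \<Rightarrow> bool" where
  "elementarily_equivalent A B \<longleftrightarrow>
     (\<forall>\<phi>. fo_sentence \<phi> \<longrightarrow> (fo_models A \<phi> \<longleftrightarrow> fo_models B \<phi>))"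

end

theory Submission
  imports Defs
begin

text \<open>Both kinds of equivalence are compared with a purely combinatorial one. Two clopen sets are
  splitting equivalent to depth \<open>0\<close> if both or neither are empty, and to depth \<open>n + 1\<close> if every cut of one
  of them into two clopen pieces can be answered by a cut of the other such that corresponding pieces
  are splitting equivalent to depth \<open>n\<close>.

  If the algebras of clopen sets are elementarily equivalent, then the two spaces are splitting
  equivalent to every depth. Indeed, up to depth \<open>n\<close> the splitting class of a set is determined by
  the truth values of finitely many first-order formulas in one variable
  (\<open>split_equiv_definable\<close>), an Ehrenfeucht-Fraisse argument.

  Splitting equivalence to every depth makes all values of formulas in the algebras of continuous
  functions agree. Up to \<open>d\<close>, a function in the unit ball of the algebra of a compact
  zero-dimensional space is a step function with values in a finite \<open>d\<close>-net of the unit disc, so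
  that choosing it amounts to cutting the space into as many clopen pieces as the net has
  points. Such cuts can be copied on the other space (\<open>split_equiv_partition\<close>,
  \<open>matched_extend\<close>). Norms of polynomials are Lipschitz and connectives are uniformly continuous
  on cubes; an induction on formulas then shows that every formula has almost equal
  values at assignments that are matched closely and deeply enough
  (\<open>cform_val_close_on_matched\<close>).

  Conversely, clopen sets are the projections of the algebra of continuous functions, and
  first-order formulas about them can be expressed by continuous ones that take
  the value 0 for true and 1 for false (\<open>first_order_formula_expressible\<close>). Quantification over
  projections is replaced by quantification over the whole unit ball with a penalty for
  the failure of \<open>a * a = a\<close>. The penalty is exact, because an almost idempotent function is near a
  projection and the translated formulas are Lipschitz (\<open>expresses_ex\<close>).\<close>

section \<open>Clopen sets and splitting equivalence\<close>

definition clopenin :: "'a topology \<Rightarrow> 'a set \<Rightarrow> bool" where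
  "clopenin X U \<longleftrightarrow> openin X U \<and> closedin X U"

lemma clopenin_empty [simp]: "clopenin X {}"
  and clopenin_topspace [simp]: "clopenin X (topspace X)"
  by (auto simp: clopenin_def)

lemma clopenin_Int [intro]: "clopenin X U \<Longrightarrow> clopenin X V \<Longrightarrow> clopenin X (U \<inter> V)"
  and clopenin_Un [intro]: "clopenin X U \<Longrightarrow> clopenin X V \<Longrightarrow> clopenin X (U \<union> V)"
  and clopenin_Diff [intro]: "clopenin X U \<Longrightarrow> clopenin X V \<Longrightarrow> clopenin X (U - V)"
  by (auto simp: clopenin_def)

lemma clopenin_subset: "clopenin X U \<Longrightarrow> U \<subseteq> topspace X"
  by (auto simp: clopenin_def openin_subset)

lemma carrier_CL_algebra: "carrier (CL_algebra X) = {U. clopenin X U}"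
  by (simp add: CL_algebra_def clopenin_def)

text \<open>The two conditions of the recursive clause are the forth and the back direction. Every
  cut happens inside a single set, so that all cells of a partition can be refined in parallel and
  the depth this costs does not depend on how many cells there are.\<close>

primrec split_equiv :: "'a topology \<Rightarrow> 'b topology \<Rightarrow> nat \<Rightarrow> 'a set \<Rightarrow> 'b set \<Rightarrow> bool" where
  "split_equiv X Y 0 U V \<longleftrightarrow> (U = {} \<longleftrightarrow> V = {})"
| "split_equiv X Y (Suc n) U V \<longleftrightarrow>
     (\<forall>U1. clopenin X U1 \<and> U1 \<subseteq> U \<longrightarrow>
        (\<exists>V1. clopenin Y V1 \<and> V1 \<subseteq> V \<and> split_equiv X Y n U1 V1 \<and> split_equiv X Y n (U - U1) (V - V1))) \<and>
     (\<forall>V1. clopenin Y V1 \<and> V1 \<subseteq> V \<longrightarrow>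
        (\<exists>U1. clopenin X U1 \<and> U1 \<subseteq> U \<and> split_equiv X Y n U1 V1 \<and> split_equiv X Y n (U - U1) (V - V1)))"

lemma split_equiv_sym: "split_equiv X Y n U V \<longleftrightarrow> split_equiv Y X n V U"
  by (induction n arbitrary: U V) (auto; metis)+

lemma split_equiv_empty_iff:
  assumes "clopenin X U" "clopenin Y V" "split_equiv X Y n U V"
  shows "U = {} \<longleftrightarrow> V = {}"
  using assms
proof (induction n arbitrary: U V)
  case (Suc n)
  then show ?case by (metis clopenin_empty order_refl split_equiv.simps(2) subset_empty)
qed simp

lemma split_equiv_empty [simp]: "split_equiv X Y n {} {}"
  by (induction n) auto

text \<open>The trivial cut of \<open>U\<close> into \<open>U\<close> and the empty set must be answered by the trivial cut of \<open>V\<close>.\<close>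

lemma split_equiv_Suc_imp:
  assumes "clopenin X U" "clopenin Y V" "split_equiv X Y (Suc n) U V"
  shows "split_equiv X Y n U V"
proof -
  obtain V1 where "clopenin Y V1" "V1 \<subseteq> V" "split_equiv X Y n U V1" "split_equiv X Y n (U - U) (V - V1)"
    using assms by (metis order_refl split_equiv.simps(2))
  moreover from this have "V - V1 = {}"
    using split_equiv_empty_iff[of X "{}" Y "V - V1" n] assms by auto
  ultimately show ?thesis by (metis Diff_eq_empty_iff subset_antisym)
qed

lemma split_equiv_mono:
  assumes "m \<le> n" "clopenin X U" "clopenin Y V" "split_equiv X Y n U V"
  shows "split_equiv X Y m U V"
  using assms(1,4) by (induction n rule: dec_induct) (use assms split_equiv_Suc_imp in blast)+

text \<open>A finite partition, given as the fibres of a function into \<open>J\<close>, is cut off one cell at a time, at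
  the cost of one step of depth per cell.\<close>

lemma split_equiv_partition:
  assumes "finite J" "clopenin X U" "clopenin Y V" "split_equiv X Y (n + card J) U V"
    and "\<And>x. x \<in> U \<Longrightarrow> g x \<in> J" and "\<And>j. clopenin X {x \<in> U. g x = j}"
  shows "\<exists>h. (\<forall>y\<in>V. h y \<in> J) \<and> 
    (\<forall>j. clopenin Y {y \<in> V. h y = j} \<and> split_equiv X Y n {x \<in> U. g x = j} {y \<in> V. h y = j})"
  using assms
proof (induction J arbitrary: U V rule: finite_induct)
  case empty
  then have "U = {}" by auto
  moreover from this have "V = {}" using split_equiv_empty_iff[of X U Y V n] empty by simp
  ultimately show ?case by auto
next
  case (insert j J)
  let ?U1 = "{x \<in> U. g x = j}"
  have "split_equiv X Y (Suc (n + card J)) U V" using insert by simp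
  \<comment> \<open>The cell of the new index is cut off first; the rest of the partition lives on its complement.\<close>
  then obtain V1 where V1: "clopenin Y V1" "V1 \<subseteq> V" "split_equiv X Y (n + card J) ?U1 V1"
    "split_equiv X Y (n + card J) (U - ?U1) (V - V1)"
    using insert.prems(5)[of j] by (auto simp: split_equiv.simps)
  have "\<exists>h. (\<forall>y\<in>V - V1. h y \<in> J) \<and>
    (\<forall>i. clopenin Y {y \<in> V - V1. h y = i} \<and> split_equiv X Y n {x \<in> U - ?U1. g x = i} {y \<in> V - V1. h y = i})"
  proof (rule insert.IH)
    show "clopenin X (U - ?U1)" using insert.prems(1,5) by blast
    show "clopenin Y (V - V1)" using insert.prems(2) V1(1) by blast
    have "{x \<in> U - ?U1. g x = i} = (if i = j then {} else {x \<in> U. g x = i})" for i by auto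
    then show "clopenin X {x \<in> U - ?U1. g x = i}" for i
      using insert.prems(5)[of i] by simp
    show "split_equiv X Y (n + card J) (U - ?U1) (V - V1)" by (rule V1(4))
    show "g x \<in> J" if "x \<in> U - ?U1" for x using that insert.prems(4)[of x] by auto
  qed
  then obtain h where h: "\<And>y. y \<in> V - V1 \<Longrightarrow> h y \<in> J"
      "\<And>i. clopenin Y {y \<in> V - V1. h y = i}"
      "\<And>i. split_equiv X Y n {x \<in> U - ?U1. g x = i} {y \<in> V - V1. h y = i}" by blast
  define h' where "h' y = (if y \<in> V1 then j else h y)" for y
  have "split_equiv X Y n ?U1 V1"
    using split_equiv_mono[OF _ _ V1(1,3)] insert.prems(5)[of j] by simp
  moreover have "{y \<in> V. h' y = j} = V1"
    using V1(2) h(1) insert.hyps(2) by (auto simp: h'_def)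
  moreover have "{y \<in> V. h' y = i} = {y \<in> V - V1. h y = i}" "{x \<in> U. g x = i} = {x \<in> U - ?U1. g x = i}"
      if "i \<noteq> j" for i
    using that by (auto simp: h'_def)
  ultimately have "clopenin Y {y \<in> V. h' y = i} \<and> split_equiv X Y n {x \<in> U. g x = i} {y \<in> V. h' y = i}" for i
    using h(2,3)[of i] V1(1) by (cases "i = j") auto
  moreover have "\<forall>y\<in>V. h' y \<in> insert j J" using h(1) by (auto simp: h'_def)
  ultimately show ?case by blast
qed

section \<open>First-order definability of splitting equivalence\<close>

definition conjunction :: "fo_form list \<Rightarrow> fo_form" where
  "conjunction fs = foldr FAnd fs (FEq BBot BBot)"

lemma fo_sat_conjunction [simp]: "fo_sat B (conjunction fs) \<sigma> \<longleftrightarrow> (\<forall>f\<in>set fs. fo_sat B f \<sigma>)"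
  unfolding conjunction_def by (induction fs) auto

lemma fo_vars_conjunction [simp]: "fo_vars (conjunction fs) = (\<Union>f\<in>set fs. fo_vars f)"
  unfolding conjunction_def by (induction fs) auto

text \<open>Formulas in one variable are functions of the index of that variable, so that they can be
  applied to the freshly bound pieces below without a substitution operation.\<close>

definition type_form :: "(nat \<Rightarrow> fo_form) list \<Rightarrow> (nat \<Rightarrow> fo_form) set \<Rightarrow> nat \<Rightarrow> fo_form" where
  "type_form \<Phi> S v = conjunction (map (\<lambda>\<phi>. if \<phi> \<in> S then \<phi> v else FNot (\<phi> v)) \<Phi>)"

text \<open>The quantified variables are the pieces of a cut of the set \<open>v\<close>. Their indices cannot clash with
  the only free variable.\<close>

definition split_form :: "(nat \<Rightarrow> fo_form) list \<Rightarrow> (nat \<Rightarrow> fo_form) set \<times> (nat \<Rightarrow> fo_form) set \<Rightarrow>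
    nat \<Rightarrow> fo_form" where
  "split_form \<Phi> ST v = FEx (v+1) (FEx (v+2) (conjunction
     [FEq (BMeet (BVar (v+1)) (BVar (v+2))) BBot, FEq (BJoin (BVar (v+1)) (BVar (v+2))) (BVar v),
      type_form \<Phi> (fst ST) (v+1), type_form \<Phi> (snd ST) (v+2)]))"

text \<open>The formulas are evaluated at shifted indices and under assignments changed by the outer
  quantifiers; this property allows reading their truth values as properties of single sets.\<close>

definition unary :: "'a topology \<Rightarrow> (nat \<Rightarrow> fo_form) \<Rightarrow> bool" where
  "unary X \<phi> \<longleftrightarrow> (\<forall>v \<sigma>. fo_sat (CL_algebra X) (\<phi> v) \<sigma> \<longleftrightarrow> fo_sat (CL_algebra X) (\<phi> 0) (\<lambda>_. \<sigma> v))"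

abbreviation holds_at :: "'a topology \<Rightarrow> (nat \<Rightarrow> fo_form) \<Rightarrow> 'a set \<Rightarrow> bool" where
  "holds_at X \<phi> U \<equiv> fo_sat (CL_algebra X) (\<phi> 0) (\<lambda>_. U)"

lemma fo_sat_type_form:
  assumes "\<forall>\<phi>\<in>set \<Phi>. unary X \<phi>"
  shows "fo_sat (CL_algebra X) (type_form \<Phi> S v) \<sigma> \<longleftrightarrow> (\<forall>\<phi>\<in>set \<Phi>. \<phi> \<in> S \<longleftrightarrow> holds_at X \<phi> (\<sigma> v))"
  proof -
  have "fo_sat (CL_algebra X) (\<phi> v) \<sigma> \<longleftrightarrow> holds_at X \<phi> (\<sigma> v)" if "\<phi> \<in> set \<Phi>" for \<phi>
    using assms that unfolding unary_def by blast
  then show ?thesis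
    by (simp only: type_form_def fo_sat_conjunction set_map ball_simps) auto
qed

lemma fo_sat_split_form:
  assumes "\<forall>\<phi>\<in>set \<Phi>. unary X \<phi>"
  shows "fo_sat (CL_algebra X) (split_form \<Phi> (S,T) v) \<sigma> \<longleftrightarrow>
    (\<exists>U1 U2. clopenin X U1 \<and> clopenin X U2 \<and> U1 \<inter> U2 = {} \<and> U1 \<union> U2 = \<sigma> v \<and>
       (\<forall>\<phi>\<in>set \<Phi>. \<phi> \<in> S \<longleftrightarrow> holds_at X \<phi> U1) \<and> (\<forall>\<phi>\<in>set \<Phi>. \<phi> \<in> T \<longleftrightarrow> holds_at X \<phi> U2))"
  unfolding split_form_def
  by (simp add: fo_sat_type_form[OF assms] carrier_CL_algebra) (auto simp: CL_algebra_def)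

text \<open>For depth \<open>n + 1\<close>, the formulas state, for each pair of patterns of truth values of the finitely many
  formulas for depth \<open>n\<close>, whether a cut realizes it. If two sets agree on these statements, then
  a cut of one is answered by any cut of the other with the same pair of patterns.\<close>

lemma split_equiv_definable:
  "\<exists>\<Phi>. (\<forall>\<phi>\<in>set \<Phi>. unary X \<phi> \<and> unary Y \<phi> \<and> (\<forall>v. fo_vars (\<phi> v) \<subseteq> {v})) \<and>
     (\<forall>U V. clopenin X U \<longrightarrow> clopenin Y V \<longrightarrow> (\<forall>\<phi>\<in>set \<Phi>. holds_at X \<phi> U \<longleftrightarrow> holds_at Y \<phi> V) \<longrightarrow>
        split_equiv X Y n U V)"
proof (induction n)
  case 0
  show ?case
    by (rule exI[of _ "[\<lambda>v. FEq (BVar v) BBot]"]) (auto simp: unary_def CL_algebra_def)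
next
  case (Suc n)
  then obtain \<Phi> where \<Phi>: "\<forall>\<phi>\<in>set \<Phi>. unary X \<phi> \<and> unary Y \<phi> \<and> (\<forall>v. fo_vars (\<phi> v) \<subseteq> {v})"
    and IH: "\<And>U V. clopenin X U \<Longrightarrow> clopenin Y V \<Longrightarrow>
      (\<forall>\<phi>\<in>set \<Phi>. holds_at X \<phi> U \<longleftrightarrow> holds_at Y \<phi> V) \<Longrightarrow> split_equiv X Y n U V"
    by (elim exE conjE) (rule that, assumption, simp)
  have un: "\<forall>\<phi>\<in>set \<Phi>. unary X \<phi>" "\<forall>\<phi>\<in>set \<Phi>. unary Y \<phi>"
    and vars: "\<And>\<phi> v. \<phi> \<in> set \<Phi> \<Longrightarrow> fo_vars (\<phi> v) \<subseteq> {v}"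
    using \<Phi> by simp_all
  note satX = fo_sat_split_form[of \<Phi> X, OF un(1)] and satY = fo_sat_split_form[of \<Phi> Y, OF un(2)]
  obtain \<Psi> where \<Psi>: "set \<Psi> = split_form \<Phi> ` (Pow (set \<Phi>) \<times> Pow (set \<Phi>))"
    using finite_list[of "split_form \<Phi> ` (Pow (set \<Phi>) \<times> Pow (set \<Phi>))"] by auto
  have "fo_vars (type_form \<Phi> S v) \<subseteq> {v}" for S v
    using vars by (fastforce simp: type_form_def)
  then have "fo_vars (split_form \<Phi> ST v) \<subseteq> {v}" for ST v
    unfolding split_form_def by fastforce
  moreover have "unary X (split_form \<Phi> ST)" "unary Y (split_form \<Phi> ST)" for ST
    by (cases ST; simp add: unary_def satX satY)+
  moreover have "split_equiv X Y (Suc n) U V"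
    if UV: "clopenin X U" "clopenin Y V" and ag: "\<forall>\<phi>\<in>set \<Psi>. holds_at X \<phi> U \<longleftrightarrow> holds_at Y \<phi> V" for U V
  proof -
    have ag': "holds_at X (split_form \<Phi> (S,T)) U \<longleftrightarrow> holds_at Y (split_form \<Phi> (S,T)) V"
      if "S \<subseteq> set \<Phi>" "T \<subseteq> set \<Phi>" for S T using ag that by (simp add: \<Psi>)
    show ?thesis
      unfolding split_equiv.simps
    proof (intro conjI allI impI; elim conjE)
      fix U1 assume U1: "clopenin X U1" "U1 \<subseteq> U"
      let ?S = "{\<phi> \<in> set \<Phi>. holds_at X \<phi> U1}" and ?T = "{\<phi> \<in> set \<Phi>. holds_at X \<phi> (U - U1)}"
      have "holds_at X (split_form \<Phi> (?S,?T)) U"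
        unfolding satX using U1 UV by (intro exI[of _ U1] exI[of _ "U - U1"]) auto
      then have "holds_at Y (split_form \<Phi> (?S,?T)) V" by (subst ag'[symmetric]) auto
      then obtain V1 V2 where V: "clopenin Y V1" "clopenin Y V2" "V1 \<inter> V2 = {}" "V1 \<union> V2 = V"
        "\<forall>\<phi>\<in>set \<Phi>. \<phi> \<in> ?S \<longleftrightarrow> holds_at Y \<phi> V1" "\<forall>\<phi>\<in>set \<Phi>. \<phi> \<in> ?T \<longleftrightarrow> holds_at Y \<phi> V2"
        unfolding satY by blast
      then have "V2 = V - V1" by auto
      then show "\<exists>V1. clopenin Y V1 \<and> V1 \<subseteq> V \<and> split_equiv X Y n U1 V1 \<and> split_equiv X Y n (U - U1) (V - V1)"
        using V U1 UV by (intro exI[of _ V1] conjI IH) auto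
    next
      fix V1 assume V1: "clopenin Y V1" "V1 \<subseteq> V"
      let ?S = "{\<phi> \<in> set \<Phi>. holds_at Y \<phi> V1}" and ?T = "{\<phi> \<in> set \<Phi>. holds_at Y \<phi> (V - V1)}"
      have "holds_at Y (split_form \<Phi> (?S,?T)) V"
        unfolding satY using V1 UV by (intro exI[of _ V1] exI[of _ "V - V1"]) auto
      then have "holds_at X (split_form \<Phi> (?S,?T)) U" by (subst ag') auto
      then obtain U1 U2 where U: "clopenin X U1" "clopenin X U2" "U1 \<inter> U2 = {}" "U1 \<union> U2 = U"
        "\<forall>\<phi>\<in>set \<Phi>. \<phi> \<in> ?S \<longleftrightarrow> holds_at X \<phi> U1" "\<forall>\<phi>\<in>set \<Phi>. \<phi> \<in> ?T \<longleftrightarrow> holds_at X \<phi> U2"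
        unfolding satX by blast
      then have "U2 = U - U1" by auto
      then show "\<exists>U1. clopenin X U1 \<and> U1 \<subseteq> U \<and> split_equiv X Y n U1 V1 \<and> split_equiv X Y n (U - U1) (V - V1)"
        using U V1 UV by (intro exI[of _ U1] conjI IH) auto
    qed
  qed
  ultimately show ?case by (intro exI[of _ \<Psi>]) (auto simp: \<Psi>)
qed

lemma fo_models_top:
  assumes "unary X \<phi>"
  shows "fo_models (CL_algebra X) (FEx 0 (FAnd (FEq (BVar 0) BTop) (\<phi> 0))) \<longleftrightarrow> holds_at X \<phi> (topspace X)"
proof -
  have "fo_sat (CL_algebra X) (\<phi> 0) \<sigma> \<longleftrightarrow> holds_at X \<phi> (\<sigma> 0)" for \<sigma>
    using assms unfolding unary_def by blast
  moreover have "ba_top (CL_algebra X) = topspace X" by (simp add: CL_algebra_def)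
  ultimately show ?thesis
    by (simp add: fo_models_def carrier_CL_algebra) (metis clopenin_topspace fun_upd_same)
qed

lemma elementarily_equivalent_imp_split_equiv:
  assumes "elementarily_equivalent (CL_algebra X) (CL_algebra Y)"
  shows "split_equiv X Y n (topspace X) (topspace Y)"
proof -
  obtain \<Phi> where \<Phi>: "\<forall>\<phi>\<in>set \<Phi>. unary X \<phi> \<and> unary Y \<phi> \<and> (\<forall>v. fo_vars (\<phi> v) \<subseteq> {v})"
    and main: "\<And>U V. clopenin X U \<Longrightarrow> clopenin Y V \<Longrightarrow>
      (\<forall>\<phi>\<in>set \<Phi>. holds_at X \<phi> U \<longleftrightarrow> holds_at Y \<phi> V) \<Longrightarrow> split_equiv X Y n U V"
    using split_equiv_definable[of X Y n] by (elim exE conjE) (rule that, assumption, simp)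
  have "holds_at X \<phi> (topspace X) \<longleftrightarrow> holds_at Y \<phi> (topspace Y)" if \<phi>: "\<phi> \<in> set \<Phi>" for \<phi>
  proof -
    have "fo_vars (\<phi> 0) \<subseteq> {0}" using \<Phi> \<phi> by simp
    then have "fo_sentence (FEx 0 (FAnd (FEq (BVar 0) BTop) (\<phi> 0)))"
      by (auto simp: fo_sentence_def)
    moreover have "unary X \<phi>" "unary Y \<phi>" using \<Phi> \<phi> by simp_all
    ultimately show ?thesis
      using assms unfolding elementarily_equivalent_def by (metis fo_models_top)
  qed
  then show ?thesis by (intro main) auto
qed

section \<open>Values of formulas in algebras of continuous functions\<close>

text \<open>The shape in which suprema over different index sets are compared throughout: index sets need
  not correspond, it suffices that every element has a partner with a close value.\<close>

lemma SUP_close: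
  fixes f :: "'i \<Rightarrow> real" and g :: "'j \<Rightarrow> real"
  assumes "A \<noteq> {}" "B \<noteq> {}" "bdd_above (f ` A)" "bdd_above (g ` B)"
    and "\<And>a. a \<in> A \<Longrightarrow> \<exists>b\<in>B. \<bar>f a - g b\<bar> \<le> e" "\<And>b. b \<in> B \<Longrightarrow> \<exists>a\<in>A. \<bar>f a - g b\<bar> \<le> e"
  shows "\<bar>(SUP a\<in>A. f a) - (SUP b\<in>B. g b)\<bar> \<le> e"
proof -
  have "(SUP a\<in>A. f a) \<le> (SUP b\<in>B. g b) + e"
  proof (rule cSUP_least[OF assms(1)])
    fix a assume "a \<in> A"
    then obtain b where "b \<in> B" "\<bar>f a - g b\<bar> \<le> e" using assms(5) by blast
    moreover have "g b \<le> (SUP b\<in>B. g b)" using cSUP_upper[OF \<open>b \<in> B\<close> assms(4)] .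
    ultimately show "f a \<le> (SUP b\<in>B. g b) + e" by linarith
  qed
  moreover have "(SUP b\<in>B. g b) \<le> (SUP a\<in>A. f a) + e"
  proof (rule cSUP_least[OF assms(2)])
    fix b assume "b \<in> B"
    then obtain a where "a \<in> A" "\<bar>f a - g b\<bar> \<le> e" using assms(6) by blast
    moreover have "f a \<le> (SUP a\<in>A. f a)" using cSUP_upper[OF \<open>a \<in> A\<close> assms(3)] .
    ultimately show "g b \<le> (SUP a\<in>A. f a) + e" by linarith
  qed
  ultimately show ?thesis by linarith
qed

lemma INF_close:
  fixes f :: "'i \<Rightarrow> real" and g :: "'j \<Rightarrow> real"
  assumes "A \<noteq> {}" "B \<noteq> {}" "bdd_below (f ` A)" "bdd_below (g ` B)"
    and "\<And>a. a \<in> A \<Longrightarrow> \<exists>b\<in>B. \<bar>f a - g b\<bar> \<le> e" "\<And>b. b \<in> B \<Longrightarrow> \<exists>a\<in>A. \<bar>f a - g b\<bar> \<le> e"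
  shows "\<bar>(INF a\<in>A. f a) - (INF b\<in>B. g b)\<bar> \<le> e"
proof -
  have "(INF b\<in>B. g b) - e \<le> (INF a\<in>A. f a)"
  proof (rule cINF_greatest[OF assms(1)])
    fix a assume "a \<in> A"
    then obtain b where "b \<in> B" "\<bar>f a - g b\<bar> \<le> e" using assms(5) by blast
    moreover have "(INF b\<in>B. g b) \<le> g b" using cINF_lower[OF assms(4) \<open>b \<in> B\<close>] .
    ultimately show "(INF b\<in>B. g b) - e \<le> f a" by linarith
  qed
  moreover have "(INF a\<in>A. f a) - e \<le> (INF b\<in>B. g b)"
  proof (rule cINF_greatest[OF assms(2)])
    fix b assume "b \<in> B"
    then obtain a where "a \<in> A" "\<bar>f a - g b\<bar> \<le> e" using assms(6) by blast
    moreover have "(INF a\<in>A. f a) \<le> f a" using cINF_lower[OF assms(3) \<open>a \<in> A\<close>] .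
    ultimately show "(INF a\<in>A. f a) - e \<le> g b" by linarith
  qed
  ultimately show ?thesis by linarith
qed

lemma locally_constant_imp_continuous_map:
  fixes b :: "'b \<Rightarrow> 'c::topological_space"
  assumes "\<And>y. y \<in> topspace Y \<Longrightarrow> \<exists>W. openin Y W \<and> y \<in> W \<and> (\<forall>w\<in>W. b w = b y)"
  shows "continuous_map Y euclidean b"
  unfolding continuous_map
proof (intro conjI allI impI)
  fix U :: "'c set"
  show "openin Y {x \<in> topspace Y. b x \<in> U}"
  proof (subst openin_subopen, intro ballI)
    fix y assume y: "y \<in> {x \<in> topspace Y. b x \<in> U}"
    then obtain W where "openin Y W" "y \<in> W" "\<forall>w\<in>W. b w = b y" using assms by blast
    moreover have "b w \<in> U" if "w \<in> W" for w using y \<open>\<forall>w\<in>W. b w = b y\<close> that by (metis mem_Collect_eq)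
    ultimately show "\<exists>T. openin Y T \<and> y \<in> T \<and> T \<subseteq> {x \<in> topspace Y. b x \<in> U}"
      using openin_subset[of Y W] by blast
  qed
qed simp

lemma bdd_above_cmod:
  assumes "compact_space X" "continuous_map X euclidean a"
  shows "bdd_above ((\<lambda>x. cmod (a x)) ` topspace X)"
proof -
  have "compactin euclidean (a ` topspace X)"
    using assms image_compactin unfolding compact_space_def by blast
  then have "bounded (a ` topspace X)" by (simp add: compact_imp_bounded)
  then show ?thesis unfolding bounded_iff bdd_above_def by auto
qed

text \<open>Compactness bounds the supremum in the norm, which is meaningless for unbounded sets.\<close>

lemma mem_closed_unit_ball:
  assumes "compact_space X"
  shows "a \<in> closed_unit_ball (C_algebra X) \<longleftrightarrow>
    continuous_map X euclidean a \<and> a \<in> extensional (topspace X) \<and> (\<forall>x\<in>topspace X. cmod (a x) \<le> 1)"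
proof (cases "topspace X = {}")
  case False
  then show ?thesis
    using cSUP_le_iff[OF False bdd_above_cmod[OF assms], of a 1]
    by (auto simp: closed_unit_ball_def C_algebra_def)
qed (auto simp: closed_unit_ball_def C_algebra_def)

lemma zero_mem_closed_unit_ball:
  "compact_space X \<Longrightarrow> \<zero>\<^bsub>C_algebra X\<^esub> \<in> closed_unit_ball (C_algebra X)"
  by (subst mem_closed_unit_ball) (auto simp: C_algebra_def)

lemma zero_C_algebra: "x \<in> topspace X \<Longrightarrow> \<zero>\<^bsub>C_algebra X\<^esub> x = 0"
  by (simp add: C_algebra_def)

text \<open>Since the operations are pointwise, values of polynomials in the algebra of functions are
  determined by values in the complex numbers.\<close>

primrec poly_eval :: "star_poly \<Rightarrow> (nat \<Rightarrow> complex) \<Rightarrow> complex" where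
  "poly_eval (PVar n) z = z n"
| "poly_eval (PConst c) z = c"
| "poly_eval (PAdd p q) z = poly_eval p z + poly_eval q z"
| "poly_eval (PMult p q) z = poly_eval p z * poly_eval q z"
| "poly_eval (PStar p) z = cnj (poly_eval p z)"

lemma poly_val_apply:
  "x \<in> topspace X \<Longrightarrow> poly_val (C_algebra X) p \<sigma> x = poly_eval p (\<lambda>v. \<sigma> v x)"
  by (induction p) (simp_all add: C_algebra_def)

lemma nrm_poly_val:
  "nrm (C_algebra X) (poly_val (C_algebra X) p \<sigma>) =
    (if topspace X = {} then 0 else SUP x\<in>topspace X. cmod (poly_eval p (\<lambda>v. \<sigma> v x)))"
proof -
  have "(SUP x\<in>topspace X. cmod (poly_val (C_algebra X) p \<sigma> x)) =
        (SUP x\<in>topspace X. cmod (poly_eval p (\<lambda>v. \<sigma> v x)))"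
    by (intro SUP_cong refl) (simp add: poly_val_apply)
  moreover have "nrm (C_algebra X) f = (if topspace X = {} then 0 else SUP x\<in>topspace X. cmod (f x))" for f
    by (simp add: C_algebra_def)
  ultimately show ?thesis by simp
qed

lemma poly_eval_bounded:
  "\<exists>M\<ge>0. \<forall>z. (\<forall>v. cmod (z v) \<le> 1) \<longrightarrow> cmod (poly_eval p z) \<le> M"
proof (induction p)
  case (PVar n)
  then show ?case by (intro exI[of _ 1]) auto
next
  case (PConst c)
  then show ?case by (intro exI[of _ "cmod c"]) auto
next
  case (PAdd p q)
  then obtain M N where "M \<ge> 0" "N \<ge> 0" and
    *: "\<And>z. \<forall>v. cmod (z v) \<le> 1 \<Longrightarrow> cmod (poly_eval p z) \<le> M" "\<And>z. \<forall>v. cmod (z v) \<le> 1 \<Longrightarrow> cmod (poly_eval q z) \<le> N"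
    by blast
  then show ?case
    by (intro exI[of _ "M + N"]) (auto intro!: norm_triangle_le add_mono)
next
  case (PMult p q)
  then obtain M N where "M \<ge> 0" "N \<ge> 0" and
    *: "\<And>z. \<forall>v. cmod (z v) \<le> 1 \<Longrightarrow> cmod (poly_eval p z) \<le> M" "\<And>z. \<forall>v. cmod (z v) \<le> 1 \<Longrightarrow> cmod (poly_eval q z) \<le> N"
    by blast
  then show ?case
    by (intro exI[of _ "M * N"]) (auto simp: norm_mult intro!: mult_mono)
qed auto

text \<open>The distance bound ranges over all variables, which avoids any bookkeeping of the variables
  that occur.\<close>

lemma poly_eval_lipschitz:
  "\<exists>L\<ge>0. \<forall>z w d. (\<forall>v. cmod (z v) \<le> 1) \<longrightarrow> (\<forall>v. cmod (w v) \<le> 1) \<longrightarrow> (\<forall>v. cmod (z v - w v) \<le> d) \<longrightarrow>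
     cmod (poly_eval p z - poly_eval p w) \<le> L * d"
proof (induction p)
  case (PVar n)
  then show ?case by (intro exI[of _ 1]) auto
next
  case (PConst c)
  then show ?case by (intro exI[of _ 0]) auto
next
  case (PAdd p q)
  then obtain K L where KL: "K \<ge> 0" "L \<ge> 0"
    and p: "\<And>z w d. \<forall>v. cmod (z v) \<le> 1 \<Longrightarrow> \<forall>v. cmod (w v) \<le> 1 \<Longrightarrow> \<forall>v. cmod (z v - w v) \<le> d \<Longrightarrow>
      cmod (poly_eval p z - poly_eval p w) \<le> K * d"
    and q: "\<And>z w d. \<forall>v. cmod (z v) \<le> 1 \<Longrightarrow> \<forall>v. cmod (w v) \<le> 1 \<Longrightarrow> \<forall>v. cmod (z v - w v) \<le> d \<Longrightarrow>
      cmod (poly_eval q z - poly_eval q w) \<le> L * d" by metis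
  show ?case
  proof (intro exI[of _ "K + L"] conjI allI impI)
    fix z w :: "nat \<Rightarrow> complex" and d assume *: "\<forall>v. cmod (z v) \<le> 1" "\<forall>v. cmod (w v) \<le> 1"
        "\<forall>v. cmod (z v - w v) \<le> d"
    have "poly_eval (PAdd p q) z - poly_eval (PAdd p q) w =
      (poly_eval p z - poly_eval p w) + (poly_eval q z - poly_eval q w)" by simp
    also have "cmod \<dots> \<le> K * d + L * d" by (intro norm_triangle_le add_mono p q *)
    finally show "cmod (poly_eval (PAdd p q) z - poly_eval (PAdd p q) w) \<le> (K + L) * d"
      by (simp add: distrib_right)
  qed (use KL in simp)
next
  case (PMult p q)
  then obtain K L where KL: "K \<ge> 0" "L \<ge> 0"
    and p: "\<And>z w d. \<forall>v. cmod (z v) \<le> 1 \<Longrightarrow> \<forall>v. cmod (w v) \<le> 1 \<Longrightarrow> \<forall>v. cmod (z v - w v) \<le> d \<Longrightarrow>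
      cmod (poly_eval p z - poly_eval p w) \<le> K * d"
    and q: "\<And>z w d. \<forall>v. cmod (z v) \<le> 1 \<Longrightarrow> \<forall>v. cmod (w v) \<le> 1 \<Longrightarrow> \<forall>v. cmod (z v - w v) \<le> d \<Longrightarrow>
      cmod (poly_eval q z - poly_eval q w) \<le> L * d" by metis
  obtain M N where MN: "M \<ge> 0" "N \<ge> 0" 
    and M: "\<And>z. \<forall>v. cmod (z v) \<le> 1 \<Longrightarrow> cmod (poly_eval p z) \<le> M"
    and N: "\<And>z. \<forall>v. cmod (z v) \<le> 1 \<Longrightarrow> cmod (poly_eval q z) \<le> N"
    using poly_eval_bounded by metis
  show ?case
  proof (intro exI[of _ "M * L + N * K"] conjI allI impI)
    fix z w :: "nat \<Rightarrow> complex" and d assume *: "\<forall>v. cmod (z v) \<le> 1" "\<forall>v. cmod (w v) \<le> 1"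
        "\<forall>v. cmod (z v - w v) \<le> d"
    have "poly_eval (PMult p q) z - poly_eval (PMult p q) w =
      poly_eval p z * (poly_eval q z - poly_eval q w) + poly_eval q w * (poly_eval p z - poly_eval p w)"
      by (simp add: algebra_simps)
    also have "cmod \<dots> \<le> M * (L * d) + N * (K * d)"
      unfolding norm_mult[symmetric]
      by (intro norm_triangle_le add_mono) (auto simp: norm_mult intro!: mult_mono p q M N * MN)
    finally show "cmod (poly_eval (PMult p q) z - poly_eval (PMult p q) w) \<le> (M * L + N * K) * d"
      by (simp add: algebra_simps)
  qed (use KL MN in simp)
next
  case (PStar p)
  then show ?case by (simp flip: complex_cnj_diff)
qed

definition ball_assignment :: "'a topology \<Rightarrow> (nat \<Rightarrow> 'a \<Rightarrow> complex) \<Rightarrow> bool" where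
  "ball_assignment X \<sigma> \<longleftrightarrow> (\<forall>v. \<sigma> v \<in> closed_unit_ball (C_algebra X))"

lemma ball_assignment_cmod_le:
  "compact_space X \<Longrightarrow> ball_assignment X \<sigma> \<Longrightarrow> x \<in> topspace X \<Longrightarrow> \<forall>v. cmod (\<sigma> v x) \<le> 1"
  by (auto simp: ball_assignment_def mem_closed_unit_ball)

lemma ball_assignment_upd:
  "ball_assignment X \<sigma> \<Longrightarrow> a \<in> closed_unit_ball (C_algebra X) \<Longrightarrow> ball_assignment X (\<sigma>(n := a))"
  by (simp add: ball_assignment_def)

lemma ball_assignment_zero: "compact_space X \<Longrightarrow> ball_assignment X (\<lambda>_. \<zero>\<^bsub>C_algebra X\<^esub>)"
  by (simp add: ball_assignment_def zero_mem_closed_unit_ball)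

lemma bdd_above_poly_eval:
  assumes "compact_space X" "ball_assignment X \<sigma>"
  shows "bdd_above ((\<lambda>x. cmod (poly_eval p (\<lambda>v. \<sigma> v x))) ` topspace X)"
proof -
  obtain M where "\<And>z. \<forall>v. cmod (z v) \<le> 1 \<Longrightarrow> cmod (poly_eval p z) \<le> M"
    using poly_eval_bounded by metis
  then have "cmod (poly_eval p (\<lambda>v. \<sigma> v x)) \<le> M" if "x \<in> topspace X" for x
    using that by (intro \<open>\<And>z. \<forall>v. cmod (z v) \<le> 1 \<Longrightarrow> _\<close> ball_assignment_cmod_le[OF assms])
  then show ?thesis by (auto intro!: bdd_aboveI)
qed

lemma nrm_poly_val_close:
  assumes "compact_space X" "compact_space Y" "ball_assignment X \<sigma>" "ball_assignment Y \<tau>" "0 \<le> e"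
    and "\<And>x. x \<in> topspace X \<Longrightarrow> \<exists>y\<in>topspace Y. cmod (poly_eval p (\<lambda>v. \<sigma> v x) - poly_eval p (\<lambda>v. \<tau> v y)) \<le> e"
    and "\<And>y. y \<in> topspace Y \<Longrightarrow> \<exists>x\<in>topspace X. cmod (poly_eval p (\<lambda>v. \<sigma> v x) - poly_eval p (\<lambda>v. \<tau> v y)) \<le> e"
  shows "\<bar>nrm (C_algebra X) (poly_val (C_algebra X) p \<sigma>) - nrm (C_algebra Y) (poly_val (C_algebra Y) p \<tau>)\<bar> \<le> e"
proof (cases "topspace X = {}")
  case True
  then have "topspace Y = {}" using assms(7) by blast
  with True show ?thesis using \<open>0 \<le> e\<close> by (simp add: nrm_poly_val)
next
  case False
  then have "topspace Y \<noteq> {}" using assms(6) by blast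
  have "\<bar>(SUP x\<in>topspace X. cmod (poly_eval p (\<lambda>v. \<sigma> v x))) -
      (SUP y\<in>topspace Y. cmod (poly_eval p (\<lambda>v. \<tau> v y)))\<bar> \<le> e"
  proof (intro SUP_close False \<open>topspace Y \<noteq> {}\<close> bdd_above_poly_eval assms(1-4))
    show "\<exists>y\<in>topspace Y. \<bar>cmod (poly_eval p (\<lambda>v. \<sigma> v x)) - cmod (poly_eval p (\<lambda>v. \<tau> v y))\<bar> \<le> e"
      if "x \<in> topspace X" for x
      using assms(6)[OF that] by (blast intro: order_trans[OF norm_triangle_ineq3])
    show "\<exists>x\<in>topspace X. \<bar>cmod (poly_eval p (\<lambda>v. \<sigma> v x)) - cmod (poly_eval p (\<lambda>v. \<tau> v y))\<bar> \<le> e"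
      if "y \<in> topspace Y" for y
      using assms(7)[OF that] by (blast intro: order_trans[OF norm_triangle_ineq3])
  qed
  then show ?thesis using False \<open>topspace Y \<noteq> {}\<close> by (simp add: nrm_poly_val)
qed

text \<open>Restricting the argument turns a connective of arity \<open>k\<close> into a continuous function on the
  space of all real sequences, where compactness and uniform continuity from the metric space
  classes apply.\<close>

lemma continuous_connective:
  fixes k :: nat
  assumes u: "continuous_map (powertop_real {..<k}) euclideanreal u"
  shows "continuous_on UNIV (\<lambda>s. u (restrict s {..<k}))"
proof -
  have "continuous_map (powertop_real UNIV) (powertop_real {..<k}) (\<lambda>s. restrict s {..<k})"
    by (auto simp: continuous_map_componentwise intro: continuous_map_product_projection)
  then have "continuous_map (powertop_real UNIV) euclideanreal (u \<circ> (\<lambda>s. restrict s {..<k}))"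
    using u continuous_map_compose by blast
  then show ?thesis
    by (simp add: euclidean_product_topology o_def)
qed

lemma compact_cube: "compact {s :: nat \<Rightarrow> real. \<forall>i. \<bar>s i\<bar> \<le> M}"
proof -
  have "{s :: nat \<Rightarrow> real. \<forall>i. \<bar>s i\<bar> \<le> M} = (\<Pi>\<^sub>E i\<in>UNIV. {-M..M})"
    by (auto simp: PiE_def Pi_def abs_le_iff minus_le_iff)
  moreover have "compactin (powertop_real UNIV) (\<Pi>\<^sub>E i\<in>(UNIV::nat set). {-M..M})"
    by (simp add: compactin_PiE)
  ultimately show ?thesis by (simp add: euclidean_product_topology)
qed

lemma connective_bounded:
  fixes k :: nat
  assumes u: "continuous_map (powertop_real {..<k}) euclideanreal u"
  shows "\<exists>N. \<forall>s. (\<forall>i<k. \<bar>s i\<bar> \<le> M) \<longrightarrow> \<bar>u (restrict s {..<k})\<bar> \<le> N"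
proof -
  let ?C = "{s :: nat \<Rightarrow> real. \<forall>i. \<bar>s i\<bar> \<le> \<bar>M\<bar>}"
  define f where "f s = u (restrict s {..<k})" for s
  have "continuous_on ?C f"
    using continuous_on_subset[OF continuous_connective[OF u]] by (simp add: f_def[abs_def])
  then have "bounded (f ` ?C)" by (intro compact_imp_bounded compact_continuous_image compact_cube)
  then obtain N where "\<forall>x\<in>f ` ?C. norm x \<le> N" unfolding bounded_iff by (elim exE)
  then have N: "\<bar>f s\<bar> \<le> N" if "s \<in> ?C" for s using that by simp
  show ?thesis
  proof (intro exI allI impI)
    fix s :: "nat \<Rightarrow> real" assume s: "\<forall>i<k. \<bar>s i\<bar> \<le> M"
    let ?s = "\<lambda>i. if i < k then s i else 0"
    have "restrict s {..<k} = restrict ?s {..<k}" by auto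
    moreover have "?s \<in> ?C" using s by (auto intro: order_trans)
    ultimately show "\<bar>u (restrict s {..<k})\<bar> \<le> N" using N[of ?s] by (simp only: f_def)
  qed
qed

lemma connective_uniformly_continuous:
  fixes k :: nat
  assumes u: "continuous_map (powertop_real {..<k}) euclideanreal u" and "e > 0"
  shows "\<exists>d>0. \<forall>s t. (\<forall>i<k. \<bar>s i\<bar> \<le> M \<and> \<bar>t i\<bar> \<le> M \<and> \<bar>s i - t i\<bar> \<le> d) \<longrightarrow>
    \<bar>u (restrict s {..<k}) - u (restrict t {..<k})\<bar> \<le> e"
proof -
  let ?C = "{s :: nat \<Rightarrow> real. \<forall>i. \<bar>s i\<bar> \<le> \<bar>M\<bar>}"
  define f where "f s = u (restrict s {..<k})" for s
  have "continuous_on ?C f"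
    using continuous_on_subset[OF continuous_connective[OF u]] by (simp add: f_def[abs_def])
  then have "uniformly_continuous_on ?C f" by (intro compact_uniformly_continuous compact_cube)
  then obtain d where d: "d > 0" "\<forall>s\<in>?C. \<forall>t\<in>?C. dist t s < d \<longrightarrow> dist (f t) (f s) < e"
    unfolding uniformly_continuous_on_def using \<open>e > 0\<close> by meson
  show ?thesis
  proof (intro exI[of _ "d / 4"] conjI allI impI)
    fix s t :: "nat \<Rightarrow> real" 
    assume st: "\<forall>i<k. \<bar>s i\<bar> \<le> M \<and> \<bar>t i\<bar> \<le> M \<and> \<bar>s i - t i\<bar> \<le> d / 4"
    \<comment> \<open>Only the first k coordinates are known to lie in the cube; the others are set to 0.\<close>
    let ?s = "\<lambda>i. if i < k then s i else 0" and ?t = "\<lambda>i. if i < k then t i else 0"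
    \<comment> \<open>The metric on sequences is a sum of coordinate distances with weights of total 2, so differences
        up to d / 4 give a distance up to d / 2.\<close>
    have "dist ?s ?t \<le> (\<Sum>n. (1/2)^n * (d / 4))"
      unfolding dist_fun_def
    proof (rule suminf_le)
      show "(1/2)^n * min (dist (?s (from_nat n)) (?t (from_nat n))) 1 \<le> (1/2)^n * (d / 4)" for n
        using st \<open>d > 0\<close> by (intro mult_left_mono min.coboundedI1) (auto simp: dist_real_def)
      show "summable (\<lambda>n. (1/2)^n * (d / 4))" by (intro summable_mult2 summable_geometric) auto
      show "summable (\<lambda>n. (1/2)^n * min (dist (?s (from_nat n)) (?t (from_nat n))) 1)"
        by (rule summable_comparison_test'[OF summable_geometric[of "1/2"]]) (auto simp: mult_le_cancel_left1)
    qed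
    also have "\<dots> = d / 2" by (subst suminf_mult2[symmetric]) (auto simp: suminf_geometric summable_geometric)
    finally have "dist ?s ?t < d" using \<open>d > 0\<close> by linarith
    moreover have "?s \<in> ?C" "?t \<in> ?C" using st by (auto intro: order_trans)
    moreover have "restrict s {..<k} = restrict ?s {..<k}" "restrict t {..<k} = restrict ?t {..<k}" by auto
    ultimately show "\<bar>u (restrict s {..<k}) - u (restrict t {..<k})\<bar> \<le> e"
        using d(2)[rule_format, of ?t ?s] by (simp only: f_def dist_real_def less_imp_le)
  qed (use \<open>d > 0\<close> in simp)
qed

lemma cform_val_bounded:
  assumes X: "compact_space X" and "wf_cform \<phi>"
  shows "\<exists>M. \<forall>\<sigma>. ball_assignment X \<sigma> \<longrightarrow> \<bar>cform_val (C_algebra X) \<phi> \<sigma>\<bar> \<le> M"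
  using assms(2)
proof (induction \<phi>)
  case (CNorm p)
  obtain M where M: "M \<ge> 0" "\<And>z. \<forall>v. cmod (z v) \<le> 1 \<Longrightarrow> cmod (poly_eval p z) \<le> M"
    using poly_eval_bounded by metis
  show ?case
  proof (intro exI[of _ M] allI impI)
    fix \<sigma> assume "ball_assignment X \<sigma>"
    then have "cmod (poly_eval p (\<lambda>v. \<sigma> v x)) \<le> M" if "x \<in> topspace X" for x
      using that by (intro M ball_assignment_cmod_le[OF X])
    then show "\<bar>cform_val (C_algebra X) (CNorm p) \<sigma>\<bar> \<le> M"
      using \<open>M \<ge> 0\<close> by (auto simp: nrm_poly_val intro!: cSup_abs_le)
  qed
next
  case (CConn u \<phi>s)
  have "\<forall>i<length \<phi>s. \<exists>M. \<forall>\<sigma>. ball_assignment X \<sigma> \<longrightarrow> \<bar>cform_val (C_algebra X) (\<phi>s ! i) \<sigma>\<bar> \<le> M"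
    using CConn by (auto simp: list_all_iff)
  then obtain M where M: "\<And>i \<sigma>. i < length \<phi>s \<Longrightarrow> ball_assignment X \<sigma> \<Longrightarrow>
      \<bar>cform_val (C_algebra X) (\<phi>s ! i) \<sigma>\<bar> \<le> M i"
    by metis
  define K where "K = (\<Sum>i<length \<phi>s. \<bar>M i\<bar>)"
  have "M i \<le> K" if "i < length \<phi>s" for i
    using member_le_sum[of i "{..<length \<phi>s}" "\<lambda>i. \<bar>M i\<bar>"] that by (auto simp: K_def)
  then have K: "\<bar>cform_val (C_algebra X) (\<phi>s ! i) \<sigma>\<bar> \<le> K" if "i < length \<phi>s" "ball_assignment X \<sigma>" for i \<sigma>
    using M that by (meson order_trans)
  obtain N where N: "\<And>s. \<forall>i<length \<phi>s. \<bar>s i\<bar> \<le> K \<Longrightarrow> \<bar>u (restrict s {..<length \<phi>s})\<bar> \<le> N"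
    using connective_bounded[of "length \<phi>s" u K] CConn.prems by auto
  show ?case
    by (intro exI[of _ N] allI impI) (auto simp: K intro!: N)
next
  case (CSup n \<phi>)
  then obtain M where "\<And>\<sigma>. ball_assignment X \<sigma> \<Longrightarrow> \<bar>cform_val (C_algebra X) \<phi> \<sigma>\<bar> \<le> M" by auto
  then show ?case
    using zero_mem_closed_unit_ball[OF X]
    by (intro exI[of _ M] allI impI) (auto intro!: cSup_abs_le ball_assignment_upd)
next
  case (CInf n \<phi>)
  then obtain M where "\<And>\<sigma>. ball_assignment X \<sigma> \<Longrightarrow> \<bar>cform_val (C_algebra X) \<phi> \<sigma>\<bar> \<le> M" by auto
  then show ?case
    using zero_mem_closed_unit_ball[OF X]
    by (intro exI[of _ M] allI impI) (auto intro!: cInf_abs_ge ball_assignment_upd)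
qed

section \<open>Transfer of values along splitting equivalence\<close>

text \<open>The position reached after some functions have been chosen on both sides. The functions \<open>p\<close> and
  \<open>q\<close> describe clopen partitions of the spaces by labelling their points; cells with the same label
  correspond to each other. A label is the list of the net points chosen so far, as this single
  type serves for every stage of refinement. All assigned functions almost
  agree on corresponding cells.\<close>

definition matched :: "'a topology \<Rightarrow> 'b topology \<Rightarrow> nat \<Rightarrow> real \<Rightarrow> ('a \<Rightarrow> complex list) \<Rightarrow> ('b \<Rightarrow> complex list) \<Rightarrow>
    (nat \<Rightarrow> 'a \<Rightarrow> complex) \<Rightarrow> (nat \<Rightarrow> 'b \<Rightarrow> complex) \<Rightarrow> bool" where
  "matched X Y n d p q \<sigma> \<tau> \<longleftrightarrow>
     (\<forall>i. clopenin X {x \<in> topspace X. p x = i} \<and> clopenin Y {y \<in> topspace Y. q y = i} \<and>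
          split_equiv X Y n {x \<in> topspace X. p x = i} {y \<in> topspace Y. q y = i}) \<and>
     (\<forall>x\<in>topspace X. \<forall>y\<in>topspace Y. p x = q y \<longrightarrow> (\<forall>v. cmod (\<sigma> v x - \<tau> v y) \<le> d))"

lemma matched_sym:
  assumes "matched X Y n d p q \<sigma> \<tau>"
  shows "matched Y X n d q p \<tau> \<sigma>"
  unfolding matched_def
proof (intro conjI allI ballI impI)
  fix i
  show "clopenin Y {y \<in> topspace Y. q y = i}" "clopenin X {x \<in> topspace X. p x = i}"
    using assms unfolding matched_def by auto
  show "split_equiv Y X n {y \<in> topspace Y. q y = i} {x \<in> topspace X. p x = i}"
    using assms unfolding matched_def by (subst split_equiv_sym) auto
next
  fix y x v assume "y \<in> topspace Y" "x \<in> topspace X" "q y = p x"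
  then show "cmod (\<tau> v y - \<sigma> v x) \<le> d"
    using assms unfolding matched_def by (subst norm_minus_commute) auto
qed

lemma matched_mono: "m \<le> n \<Longrightarrow> d \<le> d' \<Longrightarrow> matched X Y n d p q \<sigma> \<tau> \<Longrightarrow> matched X Y m d' p q \<sigma> \<tau>"
  unfolding matched_def by (meson order_trans split_equiv_mono)

text \<open>Cells with equal labels are empty simultaneously.\<close>

lemma matched_point:
  assumes "matched X Y n d p q \<sigma> \<tau>" "x \<in> topspace X"
  shows "\<exists>y\<in>topspace Y. \<forall>v. cmod (\<sigma> v x - \<tau> v y) \<le> d"
proof -
  have "{y \<in> topspace Y. q y = p x} \<noteq> {}"
    using assms split_equiv_empty_iff[of X "{x' \<in> topspace X. p x' = p x}" Y "{y \<in> topspace Y. q y = p x}" n]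
    unfolding matched_def by blast
  then obtain y where "y \<in> topspace Y" "q y = p x" by blast
  then show ?thesis using assms unfolding matched_def by metis
qed

lemma zero_dimensional_clopenin:
  assumes "zero_dimensional X" "openin X U" "x \<in> U"
  shows "\<exists>W. clopenin X W \<and> x \<in> W \<and> W \<subseteq> U"
proof -
  obtain \<B> where "\<forall>U\<in>\<B>. openin X U \<and> closedin X U" "openin X = arbitrary union_of (\<lambda>U. U \<in> \<B>)"
    using assms(1) unfolding zero_dimensional_def by blast
  then show ?thesis using assms(2,3) unfolding clopenin_def by (metis arbitrary_union_of_alt)
qed

text \<open>The members of the cover are added one by one, each with a constant value that
  overrides the earlier ones.\<close>

lemma finite_clopen_cover_imp_step_function:
  fixes P :: "'a \<Rightarrow> 'c \<Rightarrow> bool"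
  assumes "finite \<W>" "\<And>W. W \<in> \<W> \<Longrightarrow> clopenin X W" "\<And>W. W \<in> \<W> \<Longrightarrow> \<exists>j\<in>J. \<forall>x\<in>W. P x j"
  shows "\<exists>g. (\<forall>x\<in>\<Union>\<W>. g x \<in> J \<and> P x (g x)) \<and> (\<forall>j. clopenin X {x \<in> \<Union>\<W>. g x = j})"
  using assms
proof (induction rule: finite_induct)
  case (insert W \<W>)
  then obtain g where g: "\<forall>x\<in>\<Union>\<W>. g x \<in> J \<and> P x (g x)" "\<And>j. clopenin X {x \<in> \<Union>\<W>. g x = j}" by auto
  obtain j where j: "j \<in> J" "\<forall>x\<in>W. P x j" using insert.prems(2) by blast
  define g' where "g' x = (if x \<in> W then j else g x)" for x
  have "{x \<in> \<Union>(insert W \<W>). g' x = i} = (if i = j then W else {}) \<union> ({x \<in> \<Union>\<W>. g x = i} - W)" for i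
    by (auto simp: g'_def)
  moreover have "clopenin X ((if i = j then W else {}) \<union> ({x \<in> \<Union>\<W>. g x = i} - W))" for i
    using insert.prems(1)[of W] g(2)[of i] by auto
  moreover have "\<forall>x\<in>\<Union>(insert W \<W>). g' x \<in> J \<and> P x (g' x)" using g(1) j by (auto simp: g'_def)
  ultimately show ?case by (intro exI[of _ g']) simp
qed auto

text \<open>Each point has a clopen neighbourhood on which \<open>a\<close> stays near one net point; finitely many
  of these neighbourhoods cover the space.\<close>

lemma step_function_approximation:
  assumes "compact_space X" "zero_dimensional X" "continuous_map X euclidean a"
    and net: "\<And>x. x \<in> topspace X \<Longrightarrow> \<exists>j\<in>J. cmod (a x - j) < d"
  shows "\<exists>g. (\<forall>x\<in>topspace X. g x \<in> J \<and> cmod (a x - g x) \<le> d) \<and> (\<forall>j. clopenin X {x \<in> topspace X. g x = j})"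
proof -
  define \<V> where "\<V> = {W. clopenin X W \<and> (\<exists>j\<in>J. \<forall>x\<in>W. cmod (a x - j) \<le> d)}"
  have "\<exists>W\<in>\<V>. x \<in> W" if x: "x \<in> topspace X" for x
  proof -
    obtain j where j: "j \<in> J" "cmod (a x - j) < d" using net[OF x] by blast
    have "openin X {x \<in> topspace X. a x \<in> ball j d}"
      by (rule openin_continuous_map_preimage[OF assms(3)]) simp
    then obtain W where "clopenin X W" "x \<in> W" "W \<subseteq> {x \<in> topspace X. a x \<in> ball j d}"
      using zero_dimensional_clopenin[OF assms(2)] x j
          by (metis (mono_tags, lifting) dist_norm mem_Collect_eq mem_ball norm_minus_commute)
    then have "W \<in> \<V>" unfolding \<V>_def using j(1) by (force simp: dist_norm norm_minus_commute)
    then show ?thesis using \<open>x \<in> W\<close> by blast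
  qed
  then have "topspace X \<subseteq> \<Union>\<V>" by blast
  moreover have "\<forall>W\<in>\<V>. openin X W" by (auto simp: \<V>_def clopenin_def)
  ultimately obtain \<W> where \<W>: "finite \<W>" "\<W> \<subseteq> \<V>" "topspace X \<subseteq> \<Union>\<W>"
    using assms(1) unfolding compact_space_alt by (metis subset_antisym)
  then have "\<And>W. W \<in> \<W> \<Longrightarrow> clopenin X W" "\<And>W. W \<in> \<W> \<Longrightarrow> \<exists>j\<in>J. \<forall>x\<in>W. cmod (a x - j) \<le> d"
    unfolding \<V>_def by auto
  note step = finite_clopen_cover_imp_step_function[OF \<W>(1) this]
  have "\<Union>\<W> = topspace X" using \<W>(2,3) clopenin_subset[of X] unfolding \<V>_def by blast
  then show ?thesis using step by simp
qed

lemma unit_disc_net: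
  assumes "d > 0"
  shows "\<exists>J. finite J \<and> (\<forall>j\<in>J. cmod j \<le> 1) \<and> (\<forall>z. cmod z \<le> 1 \<longrightarrow> (\<exists>j\<in>J. cmod (z - j) < d))"
proof -
  obtain J where J: "finite J" "J \<subseteq> cball (0::complex) 1" "cball 0 1 \<subseteq> (\<Union>j\<in>J. ball j d)"
    using seq_compact_imp_totally_bounded[OF compact_imp_seq_compact[OF compact_cball[of "0::complex" 1]]] assms
    by (elim allE[of _ d] impE exE conjE) auto
  have "\<exists>j\<in>J. cmod (z - j) < d" if "cmod z \<le> 1" for z
  proof -
    have "z \<in> (\<Union>j\<in>J. ball j d)" using that by (intro subsetD[OF J(3)]) simp
    then show ?thesis by (auto simp: dist_norm norm_minus_commute)
  qed
  then show ?thesis using J(1,2) by (intro exI[of _ J]) auto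
qed

text \<open>The step of the back-and-forth argument: \<open>a\<close> is replaced by a step function \<open>g\<close>, its cells are
  copied inside each cell of the partition, and \<open>b\<close> takes on each copy the net point of the
  original. Since \<open>b\<close> is constant on open cells, it is continuous.\<close>

lemma matched_extend:
  assumes X: "compact_space X" "zero_dimensional X" and Y: "compact_space Y"
    and J: "finite J" "\<And>j. j \<in> J \<Longrightarrow> cmod j \<le> 1" "\<And>z. cmod z \<le> 1 \<Longrightarrow> \<exists>j\<in>J. cmod (z - j) < d"
    and match: "matched X Y (n + card J) d p q \<sigma> \<tau>" and a: "a \<in> closed_unit_ball (C_algebra X)"
  shows "\<exists>b\<in>closed_unit_ball (C_algebra Y). \<exists>p' q'. matched X Y n d p' q' (\<sigma>(m := a)) (\<tau>(m := b))"
proof -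
  let ?F = "\<lambda>i. {x \<in> topspace X. p x = i}" and ?G = "\<lambda>i. {y \<in> topspace Y. q y = i}"
  have a': "continuous_map X euclidean a" "\<And>x. x \<in> topspace X \<Longrightarrow> cmod (a x) \<le> 1"
    using a X by (auto simp: mem_closed_unit_ball)
  obtain g where g: "\<And>x. x \<in> topspace X \<Longrightarrow> g x \<in> J \<and> cmod (a x - g x) \<le> d"
    "\<And>j. clopenin X {x \<in> topspace X. g x = j}"
    using step_function_approximation[OF X a'(1), of J d] J(3) a'(2) by metis
  have fib: "clopenin X (?F i)" "clopenin Y (?G i)" "split_equiv X Y (n + card J) (?F i) (?G i)" for i
    using match unfolding matched_def by auto
  have cut: "{x \<in> ?F i. g x = j} = ?F i \<inter> {x \<in> topspace X. g x = j}" for i j by blast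
  define good where "good i h \<longleftrightarrow> (\<forall>y\<in>?G i. h y \<in> J) \<and>
    (\<forall>j. clopenin Y {y \<in> ?G i. h y = j} \<and> split_equiv X Y n {x \<in> ?F i. g x = j} {y \<in> ?G i. h y = j})" for i h
  have "\<exists>h. good i h" for i
    unfolding good_def
  proof (rule split_equiv_partition[OF J(1) fib])
    show "g x \<in> J" if "x \<in> ?F i" for x using g(1)[of x] that by simp
    show "clopenin X {x \<in> ?F i. g x = j}" for j unfolding cut by (rule clopenin_Int[OF fib(1) g(2)])
  qed
  then obtain h where "good i (h i)" for i by metis
  then have h: "\<And>i y. y \<in> ?G i \<Longrightarrow> h i y \<in> J" "\<And>i j. clopenin Y {y \<in> ?G i. h i y = j}"
    "\<And>i j. split_equiv X Y n {x \<in> ?F i. g x = j} {y \<in> ?G i. h i y = j}"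
    unfolding good_def by simp_all
  define b where "b = (\<lambda>y\<in>topspace Y. h (q y) y)"
  define p' where "p' x = g x # p x" for x
  define q' where "q' y = h (q y) y # q y" for y
  have "continuous_map Y euclidean b"
  proof (rule locally_constant_imp_continuous_map)
    fix y assume y: "y \<in> topspace Y"
    let ?W = "{w \<in> ?G (q y). h (q y) w = h (q y) y}"
    have "openin Y ?W" using h(2)[of "q y" "h (q y) y"] by (simp only: clopenin_def)
    moreover have "y \<in> ?W" using y by blast
    moreover have "\<forall>w\<in>?W. b w = b y" using y unfolding b_def by simp
    ultimately show "\<exists>W. openin Y W \<and> y \<in> W \<and> (\<forall>w\<in>W. b w = b y)" by meson
  qed
  then have "b \<in> closed_unit_ball (C_algebra Y)"
    using h(1) J(2) by (auto simp: mem_closed_unit_ball[OF Y] b_def)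
  moreover have "matched X Y n d p' q' (\<sigma>(m := a)) (\<tau>(m := b))"
    unfolding matched_def
  proof (intro conjI allI ballI impI)
    fix i
    have eq: "{x \<in> topspace X. p' x = i} = (case i of [] \<Rightarrow> {} | j # k \<Rightarrow> {x \<in> ?F k. g x = j})"
      "{y \<in> topspace Y. q' y = i} = (case i of [] \<Rightarrow> {} | j # k \<Rightarrow> {y \<in> ?G k. h k y = j})"
      by (auto simp: p'_def q'_def split: list.split)
    have "clopenin X {x \<in> ?F k. g x = j}" for j k unfolding cut by (rule clopenin_Int[OF fib(1) g(2)])
    then show "clopenin X {x \<in> topspace X. p' x = i}" "clopenin Y {y \<in> topspace Y. q' y = i}"
      "split_equiv X Y n {x \<in> topspace X. p' x = i} {y \<in> topspace Y. q' y = i}"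
      unfolding eq using h(2,3) by (simp_all split: list.split del: mem_Collect_eq)
  next
    fix x y v assume "x \<in> topspace X" "y \<in> topspace Y" "p' x = q' y"
    then show "cmod ((\<sigma>(m := a)) v x - (\<tau>(m := b)) v y) \<le> d"
      using match g(1)[of x] unfolding matched_def by (auto simp: p'_def q'_def b_def)
  qed
  ultimately show ?thesis by blast
qed

text \<open>The bound is uniform in the matched assignments. It thereby includes the uniform continuity of
  the formula, which the passage to step functions requires.\<close>

definition close_on_matched :: "'a topology \<Rightarrow> 'b topology \<Rightarrow> cform \<Rightarrow> real \<Rightarrow> nat \<Rightarrow> real \<Rightarrow> bool" where
  "close_on_matched X Y \<phi> e n d \<longleftrightarrow> (\<forall>p q \<sigma> \<tau>. ball_assignment X \<sigma> \<longrightarrow> ball_assignment Y \<tau> \<longrightarrow>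
      matched X Y n d p q \<sigma> \<tau> \<longrightarrow>
     \<bar>cform_val (C_algebra X) \<phi> \<sigma> - cform_val (C_algebra Y) \<phi> \<tau>\<bar> \<le> e)"

lemma close_on_matched_mono:
  "m \<le> n \<Longrightarrow> d' \<le> d \<Longrightarrow> close_on_matched X Y \<phi> e m d \<Longrightarrow> close_on_matched X Y \<phi> e n d'"
  unfolding close_on_matched_def using matched_mono by blast

lemma close_on_matched_all:
  assumes "\<And>\<phi>. \<phi> \<in> set \<phi>s \<Longrightarrow> \<exists>n d. d > 0 \<and> close_on_matched X Y \<phi> e n d"
  shows "\<exists>n d. d > 0 \<and> (\<forall>\<phi>\<in>set \<phi>s. close_on_matched X Y \<phi> e n d)"
  using assms
proof (induction \<phi>s)
  case Nil
  then show ?case by (auto intro: exI[of _ 1])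
next
  case (Cons \<psi> \<phi>s)
  then obtain n d where nd: "d > 0" "\<forall>\<phi>\<in>set \<phi>s. close_on_matched X Y \<phi> e n d"
    by (meson list.set_intros(2))
  obtain m c where mc: "c > 0" "close_on_matched X Y \<psi> e m c"
    using Cons.prems[of \<psi>] by (meson list.set_intros(1))
  show ?case
  proof (intro exI conjI ballI)
    show "min c d > 0" using nd mc by simp
    show "close_on_matched X Y \<phi> e (max m n) (min c d)" if "\<phi> \<in> set (\<psi> # \<phi>s)" for \<phi>
      using that nd(2) mc(2) by (auto intro: close_on_matched_mono[rotated 2])
  qed
qed

text \<open>The back and forth conditions for one further function, in the shape needed for
  comparing suprema as well as infima.\<close>

lemma close_on_matched_quantifier:
  assumes X: "compact_space X" "zero_dimensional X" and Y: "compact_space Y" "zero_dimensional Y"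
    and "d > 0" "close_on_matched X Y \<phi> e n d"
  shows "\<exists>n'. \<forall>p q \<sigma> \<tau>. ball_assignment X \<sigma> \<longrightarrow> ball_assignment Y \<tau> \<longrightarrow> matched X Y n' d p q \<sigma> \<tau> \<longrightarrow>
    (\<forall>a\<in>closed_unit_ball (C_algebra X). \<exists>b\<in>closed_unit_ball (C_algebra Y).
      \<bar>cform_val (C_algebra X) \<phi> (\<sigma>(m := a)) - cform_val (C_algebra Y) \<phi> (\<tau>(m := b))\<bar> \<le> e) \<and>
    (\<forall>b\<in>closed_unit_ball (C_algebra Y). \<exists>a\<in>closed_unit_ball (C_algebra X).
      \<bar>cform_val (C_algebra X) \<phi> (\<sigma>(m := a)) - cform_val (C_algebra Y) \<phi> (\<tau>(m := b))\<bar> \<le> e)"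
proof -
  obtain J where J: "finite J" "\<And>j. j \<in> J \<Longrightarrow> cmod j \<le> 1" "\<And>z. cmod z \<le> 1 \<Longrightarrow> \<exists>j\<in>J. cmod (z - j) < d"
    using unit_disc_net[OF \<open>d > 0\<close>] by metis
  show ?thesis
  proof (rule exI[of _ "n + card J"], intro allI impI conjI ballI)
    fix p q \<sigma> \<tau> a
    assume *: "ball_assignment X \<sigma>" "ball_assignment Y \<tau>" "matched X Y (n + card J) d p q \<sigma> \<tau>"
      and a: "a \<in> closed_unit_ball (C_algebra X)"
    obtain b p' q' where b: "b \<in> closed_unit_ball (C_algebra Y)" "matched X Y n d p' q' (\<sigma>(m := a)) (\<tau>(m := b))"
      using matched_extend[OF X Y(1) J *(3) a] by blast
    then show "\<exists>b\<in>closed_unit_ball (C_algebra Y).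
      \<bar>cform_val (C_algebra X) \<phi> (\<sigma>(m := a)) - cform_val (C_algebra Y) \<phi> (\<tau>(m := b))\<bar> \<le> e"
      using assms(6) ball_assignment_upd[OF *(1) a] ball_assignment_upd[OF *(2) b(1)]
      unfolding close_on_matched_def by blast
  next
    fix p q \<sigma> \<tau> b
    assume *: "ball_assignment X \<sigma>" "ball_assignment Y \<tau>" "matched X Y (n + card J) d p q \<sigma> \<tau>"
      and b: "b \<in> closed_unit_ball (C_algebra Y)"
    have "matched Y X (n + card J) d q p \<tau> \<sigma>" using *(3) by (rule matched_sym)
    then obtain a p' q' where a: "a \<in> closed_unit_ball (C_algebra X)"
        "matched Y X n d q' p' (\<tau>(m := b)) (\<sigma>(m := a))"
      using matched_extend[OF Y X(1) J _ b] by blast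
    have "matched X Y n d p' q' (\<sigma>(m := a)) (\<tau>(m := b))" using a(2) by (rule matched_sym)
    then show "\<exists>a\<in>closed_unit_ball (C_algebra X).
      \<bar>cform_val (C_algebra X) \<phi> (\<sigma>(m := a)) - cform_val (C_algebra Y) \<phi> (\<tau>(m := b))\<bar> \<le> e"
      using assms(6) ball_assignment_upd[OF *(1) a(1)] ball_assignment_upd[OF *(2) b] a(1)
      unfolding close_on_matched_def by blast
  qed
qed

lemma bdd_cform_val:
  assumes "compact_space X" "wf_cform \<phi>" "ball_assignment X \<sigma>"
  shows "bdd_above ((\<lambda>a. cform_val (C_algebra X) \<phi> (\<sigma>(n := a))) ` closed_unit_ball (C_algebra X))"
    and "bdd_below ((\<lambda>a. cform_val (C_algebra X) \<phi> (\<sigma>(n := a))) ` closed_unit_ball (C_algebra X))"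
proof -
  obtain M where "\<And>\<sigma>. ball_assignment X \<sigma> \<Longrightarrow> \<bar>cform_val (C_algebra X) \<phi> \<sigma>\<bar> \<le> M"
    using cform_val_bounded[OF assms(1,2)] by blast
  then have "\<bar>cform_val (C_algebra X) \<phi> (\<sigma>(n := a))\<bar> \<le> M" if "a \<in> closed_unit_ball (C_algebra X)" for a
    using that assms(3) ball_assignment_upd by blast
  then show "bdd_above ((\<lambda>a. cform_val (C_algebra X) \<phi> (\<sigma>(n := a))) ` closed_unit_ball (C_algebra X))"
    "bdd_below ((\<lambda>a. cform_val (C_algebra X) \<phi> (\<sigma>(n := a))) ` closed_unit_ball (C_algebra X))"
    unfolding bdd_above_def bdd_below_def ball_simps by (meson abs_le_D1 abs_le_D2 minus_le_iff)+
qed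

text \<open>By induction on the formula. A norm depends only on which values are attained, hence on which cells
  are nonempty, and depth 0 is enough; a connective inherits a modulus from uniform continuity on
  a cube that contains all values of its arguments; a quantifier costs as much depth as the
  net has points.\<close>

lemma cform_val_close_on_matched:
  assumes X: "compact_space X" "zero_dimensional X" and Y: "compact_space Y" "zero_dimensional Y"
    and "wf_cform \<phi>" "e > 0"
  shows "\<exists>n d. d > 0 \<and> close_on_matched X Y \<phi> e n d"
  using assms(5,6)
proof (induction \<phi> arbitrary: e)
  case (CNorm p)
  obtain L where L: "L \<ge> 0" "\<And>z w d. \<forall>v. cmod (z v) \<le> 1 \<Longrightarrow> \<forall>v. cmod (w v) \<le> 1 \<Longrightarrow> \<forall>v. cmod (z v - w v) \<le> d \<Longrightarrow>
      cmod (poly_eval p z - poly_eval p w) \<le> L * d" using poly_eval_lipschitz by metis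
  let ?d = "e / (L + 1)"
  have d: "?d > 0" "L * ?d \<le> e" using L(1) \<open>e > 0\<close> by (auto simp: field_simps)
  have "close_on_matched X Y (CNorm p) e 0 ?d"
    unfolding close_on_matched_def
  proof (intro allI impI)
    fix f g \<sigma> \<tau> assume *: "ball_assignment X \<sigma>" "ball_assignment Y \<tau>" "matched X Y 0 ?d f g \<sigma> \<tau>"
    have close: "cmod (poly_eval p (\<lambda>v. \<sigma> v x) - poly_eval p (\<lambda>v. \<tau> v y)) \<le> e"
      if "x \<in> topspace X" "y \<in> topspace Y" "\<forall>v. cmod (\<sigma> v x - \<tau> v y) \<le> ?d" for x y
      using L(2)[OF ball_assignment_cmod_le[OF X(1) *(1) that(1)]
          ball_assignment_cmod_le[OF Y(1) *(2) that(2)] that(3)]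
        d(2) by (rule order_trans)
    show "\<bar>cform_val (C_algebra X) (CNorm p) \<sigma> - cform_val (C_algebra Y) (CNorm p) \<tau>\<bar> \<le> e"
      unfolding cform_val.simps
    proof (intro nrm_poly_val_close X Y *)
      show "\<exists>y\<in>topspace Y. cmod (poly_eval p (\<lambda>v. \<sigma> v x) - poly_eval p (\<lambda>v. \<tau> v y)) \<le> e"
          if "x \<in> topspace X" for x
        using matched_point[OF *(3) that] close[OF that] by blast
      have "matched Y X 0 ?d g f \<tau> \<sigma>" using *(3) by (rule matched_sym)
      then show "\<exists>x\<in>topspace X. cmod (poly_eval p (\<lambda>v. \<sigma> v x) - poly_eval p (\<lambda>v. \<tau> v y)) \<le> e"
          if "y \<in> topspace Y" for y
        using matched_point[of Y X 0 ?d g f \<tau> \<sigma> y] close[OF _ that] that by (metis norm_minus_commute)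
    qed (use \<open>e > 0\<close> in simp)
  qed
  then show ?case using d(1) by blast
next
  case (CConn u \<phi>s)
  let ?k = "length \<phi>s"
  have u: "continuous_map (powertop_real {..<?k}) euclideanreal u" and wf: "\<And>\<phi>. \<phi> \<in> set \<phi>s \<Longrightarrow> wf_cform \<phi>"
    using CConn.prems by (auto simp: list_all_iff)
  have "\<forall>\<phi>\<in>set \<phi>s. \<exists>M. (\<forall>\<sigma>. ball_assignment X \<sigma> \<longrightarrow> \<bar>cform_val (C_algebra X) \<phi> \<sigma>\<bar> \<le> M) \<and>
     (\<forall>\<tau>. ball_assignment Y \<tau> \<longrightarrow> \<bar>cform_val (C_algebra Y) \<phi> \<tau>\<bar> \<le> M)"
  proof
    fix \<phi> assume "\<phi> \<in> set \<phi>s"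
    then obtain A B where "\<And>\<sigma>. ball_assignment X \<sigma> \<Longrightarrow> \<bar>cform_val (C_algebra X) \<phi> \<sigma>\<bar> \<le> A"
       "\<And>\<tau>. ball_assignment Y \<tau> \<Longrightarrow> \<bar>cform_val (C_algebra Y) \<phi> \<tau>\<bar> \<le> B"
      using cform_val_bounded[OF X(1) wf] cform_val_bounded[OF Y(1) wf] by metis
    then show "\<exists>M. (\<forall>\<sigma>. ball_assignment X \<sigma> \<longrightarrow> \<bar>cform_val (C_algebra X) \<phi> \<sigma>\<bar> \<le> M) \<and>
     (\<forall>\<tau>. ball_assignment Y \<tau> \<longrightarrow> \<bar>cform_val (C_algebra Y) \<phi> \<tau>\<bar> \<le> M)"
      by (intro exI[of _ "max A B"]) (auto simp: le_max_iff_disj)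
  qed
  then obtain M where M: "\<forall>\<phi>\<in>set \<phi>s. (\<forall>\<sigma>. ball_assignment X \<sigma> \<longrightarrow> \<bar>cform_val (C_algebra X) \<phi> \<sigma>\<bar> \<le> M \<phi>) \<and>
     (\<forall>\<tau>. ball_assignment Y \<tau> \<longrightarrow> \<bar>cform_val (C_algebra Y) \<phi> \<tau>\<bar> \<le> M \<phi>)" by metis
  define K where "K = (\<Sum>\<phi>\<in>set \<phi>s. \<bar>M \<phi>\<bar>)"
  have MK: "M \<phi> \<le> K" if "\<phi> \<in> set \<phi>s" for \<phi>
    using member_le_sum[of \<phi> "set \<phi>s" "\<lambda>\<phi>. \<bar>M \<phi>\<bar>"] that by (auto simp: K_def)
  obtain c where c: "c > 0" "\<And>s t. (\<forall>i<?k. \<bar>s i\<bar> \<le> K \<and> \<bar>t i\<bar> \<le> K \<and> \<bar>s i - t i\<bar> \<le> c) \<Longrightarrow>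
    \<bar>u (restrict s {..<?k}) - u (restrict t {..<?k})\<bar> \<le> e"
    using connective_uniformly_continuous[OF u \<open>e > 0\<close>, of K] by metis
  obtain n d where nd: "d > 0" "\<forall>\<phi>\<in>set \<phi>s. close_on_matched X Y \<phi> c n d"
    using close_on_matched_all[of \<phi>s X Y c] CConn.IH wf \<open>c > 0\<close> by metis
  have "close_on_matched X Y (CConn u \<phi>s) e n d"
    unfolding close_on_matched_def
  proof (intro allI impI)
    fix p q \<sigma> \<tau> assume *: "ball_assignment X \<sigma>" "ball_assignment Y \<tau>" "matched X Y n d p q \<sigma> \<tau>"
    have "\<bar>u (\<lambda>i\<in>{..<?k}. cform_val (C_algebra X) (\<phi>s ! i) \<sigma>) -
        u (\<lambda>i\<in>{..<?k}. cform_val (C_algebra Y) (\<phi>s ! i) \<tau>)\<bar> \<le> e"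
    proof (intro c(2) allI impI conjI)
      fix i assume "i < ?k"
      then have i: "\<phi>s ! i \<in> set \<phi>s" by simp
      show "\<bar>cform_val (C_algebra X) (\<phi>s ! i) \<sigma>\<bar> \<le> K" "\<bar>cform_val (C_algebra Y) (\<phi>s ! i) \<tau>\<bar> \<le> K"
        using M i * MK[OF i] by (meson order_trans)+
      show "\<bar>cform_val (C_algebra X) (\<phi>s ! i) \<sigma> - cform_val (C_algebra Y) (\<phi>s ! i) \<tau>\<bar> \<le> c"
        using nd(2) i * unfolding close_on_matched_def by blast
    qed
    then show "\<bar>cform_val (C_algebra X) (CConn u \<phi>s) \<sigma> - cform_val (C_algebra Y) (CConn u \<phi>s) \<tau>\<bar> \<le> e"
      by (simp cong: restrict_cong)
  qed
  then show ?case using nd(1) by blast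
next
  case (CSup m \<phi>)
  have wf: "wf_cform \<phi>" using CSup.prems by simp
  obtain n d where nd: "d > 0" "close_on_matched X Y \<phi> e n d"
    using CSup.IH[OF wf \<open>e > 0\<close>] by blast
  have ne: "closed_unit_ball (C_algebra X) \<noteq> {}" "closed_unit_ball (C_algebra Y) \<noteq> {}"
    using zero_mem_closed_unit_ball X Y by blast+
  obtain n' where n': "\<forall>p q \<sigma> \<tau>. ball_assignment X \<sigma> \<longrightarrow> ball_assignment Y \<tau> \<longrightarrow> matched X Y n' d p q \<sigma> \<tau> \<longrightarrow>
    (\<forall>a\<in>closed_unit_ball (C_algebra X). \<exists>b\<in>closed_unit_ball (C_algebra Y).
      \<bar>cform_val (C_algebra X) \<phi> (\<sigma>(m := a)) - cform_val (C_algebra Y) \<phi> (\<tau>(m := b))\<bar> \<le> e) \<and>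
    (\<forall>b\<in>closed_unit_ball (C_algebra Y). \<exists>a\<in>closed_unit_ball (C_algebra X).
      \<bar>cform_val (C_algebra X) \<phi> (\<sigma>(m := a)) - cform_val (C_algebra Y) \<phi> (\<tau>(m := b))\<bar> \<le> e)"
    using close_on_matched_quantifier[OF X Y nd, of m] by (elim exE)
  have "close_on_matched X Y (CSup m \<phi>) e n' d"
    unfolding close_on_matched_def cform_val.simps using n'
        by (intro allI impI SUP_close ne bdd_cform_val X Y wf) blast+
  then show ?case using nd(1) by blast
next
  case (CInf m \<phi>)
  have wf: "wf_cform \<phi>" using CInf.prems by simp
  obtain n d where nd: "d > 0" "close_on_matched X Y \<phi> e n d"
    using CInf.IH[OF wf \<open>e > 0\<close>] by blast
  have ne: "closed_unit_ball (C_algebra X) \<noteq> {}" "closed_unit_ball (C_algebra Y) \<noteq> {}"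
    using zero_mem_closed_unit_ball X Y by blast+
  obtain n' where n': "\<forall>p q \<sigma> \<tau>. ball_assignment X \<sigma> \<longrightarrow> ball_assignment Y \<tau> \<longrightarrow> matched X Y n' d p q \<sigma> \<tau> \<longrightarrow>
    (\<forall>a\<in>closed_unit_ball (C_algebra X). \<exists>b\<in>closed_unit_ball (C_algebra Y).
      \<bar>cform_val (C_algebra X) \<phi> (\<sigma>(m := a)) - cform_val (C_algebra Y) \<phi> (\<tau>(m := b))\<bar> \<le> e) \<and>
    (\<forall>b\<in>closed_unit_ball (C_algebra Y). \<exists>a\<in>closed_unit_ball (C_algebra X).
      \<bar>cform_val (C_algebra X) \<phi> (\<sigma>(m := a)) - cform_val (C_algebra Y) \<phi> (\<tau>(m := b))\<bar> \<le> e)"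
    using close_on_matched_quantifier[OF X Y nd, of m] by (elim exE)
  have "close_on_matched X Y (CInf m \<phi>) e n' d"
    unfolding close_on_matched_def cform_val.simps using n'
        by (intro allI impI INF_close ne bdd_cform_val X Y wf) blast+
  then show ?case using nd(1) by blast
qed

text \<open>At the start, the partitions are trivial and the zero assignments agree exactly. In
  fact the values of all sentences coincide, not just their zeros.\<close>

lemma split_equiv_imp_metric_elementarily_equivalent:
  assumes X: "compact_space X" "zero_dimensional X" and Y: "compact_space Y" "zero_dimensional Y"
    and eq: "\<And>n. split_equiv X Y n (topspace X) (topspace Y)"
  shows "metric_elementarily_equivalent (C_algebra X) (C_algebra Y)"
proof -
  have "csentence_val (C_algebra X) \<phi> = csentence_val (C_algebra Y) \<phi>" if wf: "wf_cform \<phi>" for \<phi>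
  proof -
    have "\<bar>csentence_val (C_algebra X) \<phi> - csentence_val (C_algebra Y) \<phi>\<bar> \<le> e" if e: "e > 0" for e
    proof -
      obtain n d where nd: "d > 0" "close_on_matched X Y \<phi> e n d"
        using cform_val_close_on_matched[OF X Y wf e] by blast
      have fib: "{x \<in> topspace X. [] = i} = (if i = [] then topspace X else {})"
        "{y \<in> topspace Y. [] = i} = (if i = [] then topspace Y else {})" for i :: "complex list"
        by auto
      have "matched X Y n d (\<lambda>_. []) (\<lambda>_. []) (\<lambda>_. \<zero>\<^bsub>C_algebra X\<^esub>) (\<lambda>_. \<zero>\<^bsub>C_algebra Y\<^esub>)"
        unfolding matched_def fib using eq \<open>d > 0\<close> by (simp add: zero_C_algebra)
      then show ?thesis
        using nd(2) ball_assignment_zero[OF X(1)] ball_assignment_zero[OF Y(1)]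
        unfolding close_on_matched_def csentence_val_def by blast
    qed
    then show ?thesis by (metis abs_le_zero_iff eq_iff_diff_eq_0 field_le_epsilon add_0)
  qed
  then show ?thesis unfolding metric_elementarily_equivalent_def csentence_def by simp
qed

section \<open>Clopen sets as projections\<close>

definition projection :: "'a topology \<Rightarrow> 'a set \<Rightarrow> 'a \<Rightarrow> complex" where
  "projection X U = (\<lambda>x\<in>topspace X. if x \<in> U then 1 else 0)"

lemma projection_empty: "projection X {} = \<zero>\<^bsub>C_algebra X\<^esub>"
  by (simp add: projection_def C_algebra_def)

lemma projection_mem_closed_unit_ball:
  assumes "compact_space X" "clopenin X U"
  shows "projection X U \<in> closed_unit_ball (C_algebra X)"
proof -
  have "continuous_map X euclidean (projection X U)"
  proof (rule locally_constant_imp_continuous_map)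
    fix y assume y: "y \<in> topspace X"
    let ?W = "if y \<in> U then U else topspace X - U"
    have "openin X ?W" using assms(2) by (auto simp: clopenin_def)
    moreover have "y \<in> ?W" using y by auto
    moreover have "\<forall>w\<in>?W. projection X U w = projection X U y"
      using y clopenin_subset[OF assms(2)] by (auto simp: projection_def)
    ultimately show "\<exists>W. openin X W \<and> y \<in> W \<and> (\<forall>w\<in>W. projection X U w = projection X U y)"
        by (intro exI[of _ ?W] conjI)
  qed
  then show ?thesis by (auto simp: mem_closed_unit_ball[OF assms(1)] projection_def)
qed

abbreviation projections :: "'a topology \<Rightarrow> (nat \<Rightarrow> 'a set) \<Rightarrow> nat \<Rightarrow> 'a \<Rightarrow> complex" where
  "projections X \<sigma> \<equiv> \<lambda>v. projection X (\<sigma> v)"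

lemma ball_assignment_projections:
  "compact_space X \<Longrightarrow> \<forall>v. clopenin X (\<sigma> v) \<Longrightarrow> ball_assignment X (projections X \<sigma>)"
  by (simp add: ball_assignment_def projection_mem_closed_unit_ball)

abbreviation PDiff :: "star_poly \<Rightarrow> star_poly \<Rightarrow> star_poly" where
  "PDiff p q \<equiv> PAdd p (PMult (PConst (-1)) q)"

text \<open>The arithmetic of indicator functions: the union of two sets has the indicator \<open>p + q - p * q\<close>.\<close>

primrec term_poly :: "ba_term \<Rightarrow> star_poly" where
  "term_poly (BVar n) = PVar n"
| "term_poly BBot = PConst 0"
| "term_poly BTop = PConst 1"
| "term_poly (BJoin s t) = PDiff (PAdd (term_poly s) (term_poly t)) (PMult (term_poly s) (term_poly t))"
| "term_poly (BMeet s t) = PMult (term_poly s) (term_poly t)"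
| "term_poly (BCompl t) = PDiff (PConst 1) (term_poly t)"

lemma poly_vars_term_poly [simp]: "poly_vars (term_poly t) = term_vars t"
  by (induction t) auto

lemma poly_eval_term_poly:
  "x \<in> topspace X \<Longrightarrow> poly_eval (term_poly t) (\<lambda>v. projections X \<sigma> v x) =
     (if x \<in> term_val (CL_algebra X) t \<sigma> then 1 else 0)"
  by (induction t) (auto simp: projection_def CL_algebra_def)

lemma clopenin_term_val:
  "\<forall>v. clopenin X (\<sigma> v) \<Longrightarrow> clopenin X (term_val (CL_algebra X) t \<sigma>)"
  by (induction t) (auto simp: CL_algebra_def)

lemma cmod_poly_eval_le_nrm:
  assumes "compact_space X" "ball_assignment X \<sigma>" "x \<in> topspace X"
  shows "cmod (poly_eval p (\<lambda>v. \<sigma> v x)) \<le> nrm (C_algebra X) (poly_val (C_algebra X) p \<sigma>)"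
proof -
  have "cmod (poly_eval p (\<lambda>v. \<sigma> v x)) \<le> (SUP x\<in>topspace X. cmod (poly_eval p (\<lambda>v. \<sigma> v x)))"
    by (rule cSUP_upper[OF assms(3) bdd_above_poly_eval[OF assms(1,2)]])
  moreover have "topspace X \<noteq> {}" using assms(3) by blast
  ultimately show ?thesis by (simp only: nrm_poly_val if_False)
qed

lemma nrm_poly_val_nonneg:
  assumes "compact_space X" "ball_assignment X \<sigma>"
  shows "0 \<le> nrm (C_algebra X) (poly_val (C_algebra X) p \<sigma>)"
proof (cases "topspace X = {}")
  case False
  then obtain x where "x \<in> topspace X" by blast
  then show ?thesis using cmod_poly_eval_le_nrm[OF assms] norm_ge_zero order_trans by blast
qed (simp add: nrm_poly_val)

text \<open>One of the factors of \<open>z * (z - 1)\<close> has modulus at least 1/2.\<close>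

lemma nearly_idempotent_complex:
  fixes z :: complex
  assumes "cmod (z * z - z) \<le> d"
  shows "cmod (z - (if 1 / 2 \<le> cmod z then 1 else 0)) \<le> 2 * d"
proof -
  have d: "cmod z * cmod (z - 1) \<le> d"
    using assms by (simp flip: norm_mult add: right_diff_distrib)
  show ?thesis
  proof (cases "1 / 2 \<le> cmod z")
    case True
    then have "1 / 2 * cmod (z - 1) \<le> cmod z * cmod (z - 1)" by (intro mult_right_mono) auto
    with d True show ?thesis by simp
  next
    case False
    have "1 \<le> cmod z + cmod (z - 1)" using norm_triangle_ineq4[of z "z - 1"] by simp
    with False have "cmod z * (1 / 2) \<le> cmod z * cmod (z - 1)" by (intro mult_left_mono) auto
    with d False show ?thesis by simp
  qed
qed

abbreviation idempotency_defect :: "nat \<Rightarrow> star_poly" where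
  "idempotency_defect n \<equiv> PDiff (PMult (PVar n) (PVar n)) (PVar n)"

text \<open>For defect \<open>d < 1 / 8\<close>, every value of modulus at least 1/2 has modulus above
  3/4. Hence the set of points with such values can be described by a closed as well as by an open
  condition.\<close>

lemma projection_near_almost_idempotent:
  assumes X: "compact_space X" and \<sigma>: "ball_assignment X \<sigma>"
    and d: "d = nrm (C_algebra X) (poly_val (C_algebra X) (idempotency_defect n) \<sigma>)" "d < 1 / 8"
  shows "\<exists>U. clopenin X U \<and> (\<forall>x\<in>topspace X. cmod (\<sigma> n x - projection X U x) \<le> 2 * d)"
proof -
  define a where "a = \<sigma> n"
  have a: "continuous_map X euclidean a"
    using \<sigma> unfolding a_def ball_assignment_def mem_closed_unit_ball[OF X] by blast
  have le: "cmod (a x * a x - a x) \<le> d" if x: "x \<in> topspace X" for x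
  proof -
    have "cmod (poly_eval (idempotency_defect n) (\<lambda>v. \<sigma> v x)) \<le> d"
      unfolding d(1) by (rule cmod_poly_eval_le_nrm[OF X \<sigma> x])
    then show ?thesis by (simp add: a_def)
  qed
  let ?U = "{x \<in> topspace X. a x \<in> {z. 1 / 2 \<le> cmod z}}"
  have close: "cmod (a x - (if 1 / 2 \<le> cmod (a x) then 1 else 0)) \<le> 2 * d" if "x \<in> topspace X" for x
    using le[OF that] by (rule nearly_idempotent_complex)
  have "1 / 2 < cmod (a x)" if "x \<in> topspace X" "1 / 2 \<le> cmod (a x)" for x
  proof -
    have "1 \<le> cmod (a x) + cmod (a x - 1)" using norm_triangle_ineq4[of "a x" "a x - 1"] by simp
    then show ?thesis using close[OF that(1)] that(2) d(2) by simp
  qed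
  then have "?U = {x \<in> topspace X. a x \<in> {z. 1 / 2 < cmod z}}" by force
  moreover have "openin X {x \<in> topspace X. a x \<in> {z. 1 / 2 < cmod z}}"
    by (rule openin_continuous_map_preimage[OF a]) (simp add: open_Collect_less continuous_intros)
  moreover have "closedin X ?U"
    by (rule closedin_continuous_map_preimage[OF a]) (simp add: closed_Collect_le continuous_intros)
  ultimately have "clopenin X ?U" by (simp only: clopenin_def)
  moreover have "cmod (\<sigma> n x - projection X ?U x) \<le> 2 * d" if "x \<in> topspace X" for x
    using close[OF that] that by (simp add: projection_def a_def)
  ultimately show ?thesis by blast
qed

text \<open>On projections, \<open>\<psi>\<close> takes the truth value of \<open>\<phi>\<close>, with 0 as true. The other two conditions
  concern the whole unit ball; they are what the elimination of projections from
  quantifiers consumes. The Lipschitz constant \<open>L\<close> is a parameter because the coefficient in the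
  quantifier translation depends on it.\<close>

definition expresses :: "'a topology \<Rightarrow> real \<Rightarrow> fo_form \<Rightarrow> cform \<Rightarrow> bool" where
  "expresses X L \<phi> \<psi> \<longleftrightarrow>
     (\<forall>\<sigma>. ball_assignment X \<sigma> \<longrightarrow> 0 \<le> cform_val (C_algebra X) \<psi> \<sigma> \<and> cform_val (C_algebra X) \<psi> \<sigma> \<le> 1) \<and>
     (\<forall>\<sigma> \<tau> d. ball_assignment X \<sigma> \<longrightarrow> ball_assignment X \<tau> \<longrightarrow> 0 \<le> d \<longrightarrow>
        (\<forall>x\<in>topspace X. \<forall>v. cmod (\<sigma> v x - \<tau> v x) \<le> d) \<longrightarrow>
        \<bar>cform_val (C_algebra X) \<psi> \<sigma> - cform_val (C_algebra X) \<psi> \<tau>\<bar> \<le> L * d) \<and>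
     (\<forall>\<sigma>. (\<forall>v. clopenin X (\<sigma> v)) \<longrightarrow>
        cform_val (C_algebra X) \<psi> (projections X \<sigma>) = (if fo_sat (CL_algebra X) \<phi> \<sigma> then 0 else 1))"

lemma expressesI:
  assumes "\<And>\<sigma>. ball_assignment X \<sigma> \<Longrightarrow> 0 \<le> cform_val (C_algebra X) \<psi> \<sigma> \<and> cform_val (C_algebra X) \<psi> \<sigma> \<le> 1"
    and "\<And>\<sigma> \<tau> d. ball_assignment X \<sigma> \<Longrightarrow> ball_assignment X \<tau> \<Longrightarrow> 0 \<le> d \<Longrightarrow>
      (\<And>x v. x \<in> topspace X \<Longrightarrow> cmod (\<sigma> v x - \<tau> v x) \<le> d) \<Longrightarrow>
      \<bar>cform_val (C_algebra X) \<psi> \<sigma> - cform_val (C_algebra X) \<psi> \<tau>\<bar> \<le> L * d"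
    and "\<And>\<sigma>. \<forall>v. clopenin X (\<sigma> v) \<Longrightarrow>
      cform_val (C_algebra X) \<psi> (projections X \<sigma>) = (if fo_sat (CL_algebra X) \<phi> \<sigma> then 0 else 1)"
  shows "expresses X L \<phi> \<psi>"
  unfolding expresses_def using assms by simp

lemma expressesD:
  assumes "expresses X L \<phi> \<psi>"
  shows "ball_assignment X \<sigma> \<Longrightarrow> 0 \<le> cform_val (C_algebra X) \<psi> \<sigma>"
    and "ball_assignment X \<sigma> \<Longrightarrow> cform_val (C_algebra X) \<psi> \<sigma> \<le> 1"
    and "ball_assignment X \<sigma> \<Longrightarrow> ball_assignment X \<tau> \<Longrightarrow> 0 \<le> d \<Longrightarrow>
      (\<And>x v. x \<in> topspace X \<Longrightarrow> cmod (\<sigma> v x - \<tau> v x) \<le> d) \<Longrightarrow>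
      \<bar>cform_val (C_algebra X) \<psi> \<sigma> - cform_val (C_algebra X) \<psi> \<tau>\<bar> \<le> L * d"
    and "\<forall>v. clopenin X (\<rho> v) \<Longrightarrow>
      cform_val (C_algebra X) \<psi> (projections X \<rho>) = (if fo_sat (CL_algebra X) \<phi> \<rho> then 0 else 1)"
  using assms unfolding expresses_def by simp_all

lemma expresses_mono:
  assumes "expresses X L \<phi> \<psi>" "L \<le> M"
  shows "expresses X M \<phi> \<psi>"
proof (rule expressesI)
  fix \<sigma> \<tau> d assume *: "ball_assignment X \<sigma>" "ball_assignment X \<tau>" "0 \<le> d"
    "\<And>x v. x \<in> topspace X \<Longrightarrow> cmod (\<sigma> v x - \<tau> v x) \<le> d"
  have "\<bar>cform_val (C_algebra X) \<psi> \<sigma> - cform_val (C_algebra X) \<psi> \<tau>\<bar> \<le> L * d"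
    using assms(1) * by (rule expressesD)
  also have "\<dots> \<le> M * d" using \<open>L \<le> M\<close> \<open>0 \<le> d\<close> by (rule mult_right_mono)
  finally show "\<bar>cform_val (C_algebra X) \<psi> \<sigma> - cform_val (C_algebra X) \<psi> \<tau>\<bar> \<le> M * d" .
qed (use expressesD[OF assms(1)] in simp_all)

lemma expresses_cong:
  assumes "expresses X L \<phi> \<psi>" "\<And>\<sigma>. fo_sat (CL_algebra X) \<phi> \<sigma> \<longleftrightarrow> fo_sat (CL_algebra X) \<phi>' \<sigma>"
  shows "expresses X L \<phi>' \<psi>"
  using assms unfolding expresses_def by simp

definition eq_cform :: "ba_term \<Rightarrow> ba_term \<Rightarrow> cform" where
  "eq_cform s t = CConn (\<lambda>r. min 1 (r 0)) [CNorm (PDiff (term_poly s) (term_poly t))]"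

definition not_cform :: "cform \<Rightarrow> cform" where
  "not_cform \<psi> = CConn (\<lambda>r. 1 - r 0) [\<psi>]"

definition and_cform :: "cform \<Rightarrow> cform \<Rightarrow> cform" where
  "and_cform \<psi> \<theta> = CConn (\<lambda>r. max (r 0) (r 1)) [\<psi>, \<theta>]"

text \<open>The infimum over the unit ball, with a penalty that makes elements which are far from projections
  useless as witnesses.\<close>

definition ex_cform :: "real \<Rightarrow> nat \<Rightarrow> cform \<Rightarrow> cform" where
  "ex_cform K n \<psi> = CInf n (CConn (\<lambda>r. min 1 (r 0 + K * r 1)) [\<psi>, CNorm (idempotency_defect n)])"

lemma cform_val_simps:
  "cform_val A (eq_cform s t) \<sigma> = min 1 (nrm A (poly_val A (PDiff (term_poly s) (term_poly t)) \<sigma>))"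
  "cform_val A (not_cform \<psi>) \<sigma> = 1 - cform_val A \<psi> \<sigma>"
  "cform_val A (and_cform \<psi> \<theta>) \<sigma> = max (cform_val A \<psi> \<sigma>) (cform_val A \<theta> \<sigma>)"
  "cform_val A (ex_cform K n \<psi>) \<sigma> = (INF a\<in>closed_unit_ball A. min 1 (cform_val A \<psi> (\<sigma>(n := a)) +
     K * nrm A (poly_val A (idempotency_defect n) (\<sigma>(n := a)))))"
  by (simp_all add: eq_cform_def not_cform_def and_cform_def ex_cform_def)

lemma wf_cform_simps:
  "wf_cform (eq_cform s t)"
  "wf_cform (not_cform \<psi>) \<longleftrightarrow> wf_cform \<psi>"
  "wf_cform (and_cform \<psi> \<theta>) \<longleftrightarrow> wf_cform \<psi> \<and> wf_cform \<theta>"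
  "wf_cform (ex_cform K n \<psi>) \<longleftrightarrow> wf_cform \<psi>"
  unfolding eq_cform_def not_cform_def and_cform_def ex_cform_def
  by (auto intro!: continuous_intros continuous_map_product_projection)

lemma cform_vars_simps:
  "cform_vars (eq_cform s t) = term_vars s \<union> term_vars t"
  "cform_vars (not_cform \<psi>) = cform_vars \<psi>"
  "cform_vars (and_cform \<psi> \<theta>) = cform_vars \<psi> \<union> cform_vars \<theta>"
  "cform_vars (ex_cform K n \<psi>) = cform_vars \<psi> - {n}"
  unfolding eq_cform_def not_cform_def and_cform_def ex_cform_def by auto

lemma nrm_poly_val_eq_0:
  assumes "\<And>x. x \<in> topspace X \<Longrightarrow> poly_eval p (\<lambda>v. \<sigma> v x) = 0"
  shows "nrm (C_algebra X) (poly_val (C_algebra X) p \<sigma>) = 0"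
proof -
  have "(SUP x\<in>topspace X. cmod (poly_eval p (\<lambda>v. \<sigma> v x))) = (SUP x\<in>topspace X. 0)"
    by (intro SUP_cong refl) (simp add: assms)
  then show ?thesis by (simp add: nrm_poly_val)
qed


text \<open>If the two clopen sets differ, then the difference of their indicators has modulus 1 at some point.\<close>

lemma expresses_eq:
  assumes L: "\<And>z w d. \<forall>v. cmod (z v) \<le> 1 \<Longrightarrow> \<forall>v. cmod (w v) \<le> 1 \<Longrightarrow> \<forall>v. cmod (z v - w v) \<le> d \<Longrightarrow>
      cmod (poly_eval (PDiff (term_poly s) (term_poly t)) z -
          poly_eval (PDiff (term_poly s) (term_poly t)) w) \<le> L * d"
    and "0 \<le> L" and X: "compact_space X"
  shows "expresses X L (FEq s t) (eq_cform s t)"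
proof (rule expressesI)
  let ?p = "PDiff (term_poly s) (term_poly t)"
  let ?N = "\<lambda>\<sigma>. nrm (C_algebra X) (poly_val (C_algebra X) ?p \<sigma>)"
  show "0 \<le> cform_val (C_algebra X) (eq_cform s t) \<sigma> \<and> cform_val (C_algebra X) (eq_cform s t) \<sigma> \<le> 1"
    if "ball_assignment X \<sigma>" for \<sigma>
    using nrm_poly_val_nonneg[OF X that, of ?p] unfolding cform_val_simps by simp
  show "\<bar>cform_val (C_algebra X) (eq_cform s t) \<sigma> - cform_val (C_algebra X) (eq_cform s t) \<tau>\<bar> \<le> L * d"
    if *: "ball_assignment X \<sigma>" "ball_assignment X \<tau>" "0 \<le> d"
    "\<And>x v. x \<in> topspace X \<Longrightarrow> cmod (\<sigma> v x - \<tau> v x) \<le> d" for \<sigma> \<tau> d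
  proof -
    have close: "cmod (poly_eval ?p (\<lambda>v. \<sigma> v x) - poly_eval ?p (\<lambda>v. \<tau> v x)) \<le> L * d"
        if x: "x \<in> topspace X" for x
      using ball_assignment_cmod_le[OF X *(1) x] ball_assignment_cmod_le[OF X *(2) x] *(4)[OF x]
          by (intro L) auto
    have "\<bar>?N \<sigma> - ?N \<tau>\<bar> \<le> L * d"
    proof (intro nrm_poly_val_close X *(1,2))
      show "0 \<le> L * d" using *(3) \<open>0 \<le> L\<close> by simp
    qed (use close in blast)+
    then show ?thesis unfolding cform_val_simps by linarith
  qed
  show "cform_val (C_algebra X) (eq_cform s t) (projections X \<sigma>) =
      (if fo_sat (CL_algebra X) (FEq s t) \<sigma> then 0 else 1)"
    if \<sigma>: "\<forall>v. clopenin X (\<sigma> v)" for \<sigma>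
  proof -
    let ?S = "term_val (CL_algebra X) s \<sigma>" and ?T = "term_val (CL_algebra X) t \<sigma>"
    have val: "poly_eval ?p (\<lambda>v. projections X \<sigma> v x) = (if x \<in> ?S then 1 else 0) - (if x \<in> ?T then 1 else 0)"
      if "x \<in> topspace X" for x
      using that by (simp add: poly_eval_term_poly)
    show ?thesis
    proof (cases "?S = ?T")
      case True
      then have "?N (projections X \<sigma>) = 0" by (intro nrm_poly_val_eq_0) (simp only: val if_cancel diff_self)
      with True show ?thesis unfolding cform_val_simps by simp
    next
      case False
      then obtain x where x: "x \<in> topspace X" "(x \<in> ?S) \<noteq> (x \<in> ?T)"
        using clopenin_term_val[OF \<sigma>] clopenin_subset by blast
      have "1 = cmod (poly_eval ?p (\<lambda>v. projections X \<sigma> v x))" unfolding val[OF x(1)] using x(2) by auto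
      also have "\<dots> \<le> ?N (projections X \<sigma>)"
        by (rule cmod_poly_eval_le_nrm[OF X ball_assignment_projections[OF X \<sigma>] x(1)])
      finally show ?thesis using False unfolding cform_val_simps by simp
    qed
  qed
qed

lemma expresses_not:
  assumes "expresses X L \<phi> \<psi>"
  shows "expresses X L (FNot \<phi>) (not_cform \<psi>)"
proof (rule expressesI)
  show "\<bar>cform_val (C_algebra X) (not_cform \<psi>) \<sigma> - cform_val (C_algebra X) (not_cform \<psi>) \<tau>\<bar> \<le> L * d"
    if "ball_assignment X \<sigma>" "ball_assignment X \<tau>" "0 \<le> d"
        "\<And>x v. x \<in> topspace X \<Longrightarrow> cmod (\<sigma> v x - \<tau> v x) \<le> d" for \<sigma> \<tau> d
    using expressesD(3)[OF assms that] unfolding cform_val_simps by linarith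
qed (use expressesD[OF assms] in \<open>simp_all add: cform_val_simps\<close>)

lemma expresses_and:
  assumes "expresses X L \<phi> \<psi>" "expresses X L \<phi>' \<psi>'"
  shows "expresses X L (FAnd \<phi> \<phi>') (and_cform \<psi> \<psi>')"
proof (rule expressesI)
  show "\<bar>cform_val (C_algebra X) (and_cform \<psi> \<psi>') \<sigma> - cform_val (C_algebra X) (and_cform \<psi> \<psi>') \<tau>\<bar> \<le> L * d"
    if "ball_assignment X \<sigma>" "ball_assignment X \<tau>" "0 \<le> d"
        "\<And>x v. x \<in> topspace X \<Longrightarrow> cmod (\<sigma> v x - \<tau> v x) \<le> d" for \<sigma> \<tau> d
    using expressesD(3)[OF assms(1) that] expressesD(3)[OF assms(2) that] unfolding cform_val_simps by linarith
qed (use expressesD[OF assms(1)] expressesD[OF assms(2)] in \<open>simp_all add: cform_val_simps le_max_iff_disj\<close>)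

text \<open>The coefficient \<open>2 * L + 8\<close> covers both cases for an element of defect \<open>d\<close>. If \<open>d \<ge> 1 / 8\<close>, then
  \<open>8 * d \<ge> 1\<close> and the penalty alone reaches the maximal value 1. Otherwise there is a projection within
  \<open>2 * d\<close>, and moving to it changes the value of \<open>\<psi>\<close> by at most \<open>2 * L * d\<close>, which the penalty
  makes up for. So the infimum is already the minimum over the projections.\<close>

lemma expresses_ex:
  assumes X: "compact_space X" and \<psi>: "expresses X L \<phi> \<psi>" and L: "0 \<le> L" and K: "K = 2 * L + 8"
  shows "expresses X L (FEx n \<phi>) (ex_cform K n \<psi>)"
proof (rule expressesI)
  let ?B = "closed_unit_ball (C_algebra X)"
  let ?N = "\<lambda>\<sigma>. nrm (C_algebra X) (poly_val (C_algebra X) (idempotency_defect n) \<sigma>)"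
  let ?F = "\<lambda>\<sigma>. min 1 (cform_val (C_algebra X) \<psi> \<sigma> + K * ?N \<sigma>)"
  have ne: "?B \<noteq> {}" using zero_mem_closed_unit_ball[OF X] by blast
  have F: "0 \<le> ?F (\<sigma>(n := a))" "?F (\<sigma>(n := a)) \<le> 1" if "ball_assignment X \<sigma>" "a \<in> ?B" for \<sigma> a
  proof -
    have "0 \<le> cform_val (C_algebra X) \<psi> (\<sigma>(n := a))" "0 \<le> K * ?N (\<sigma>(n := a))"
      using L ball_assignment_upd[OF that] by (auto simp: K
          intro!: expressesD(1)[OF \<psi>] mult_nonneg_nonneg nrm_poly_val_nonneg X simp del: poly_val.simps)
    then show "0 \<le> ?F (\<sigma>(n := a))" "?F (\<sigma>(n := a)) \<le> 1" by linarith+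
  qed
  have bdd: "bdd_below ((\<lambda>a. ?F (\<sigma>(n := a))) ` ?B)" if "ball_assignment X \<sigma>" for \<sigma>
    using F(1)[OF that] by (intro bdd_belowI2[of _ 0])
  show range: "0 \<le> cform_val (C_algebra X) (ex_cform K n \<psi>) \<sigma> \<and> cform_val (C_algebra X) (ex_cform K n \<psi>) \<sigma> \<le> 1"
    if \<sigma>: "ball_assignment X \<sigma>" for \<sigma>
  proof
    obtain a where a: "a \<in> ?B" using ne by blast
    show "0 \<le> cform_val (C_algebra X) (ex_cform K n \<psi>) \<sigma>"
      unfolding cform_val_simps using F(1)[OF \<sigma>] by (intro cINF_greatest[OF ne])
    show "cform_val (C_algebra X) (ex_cform K n \<psi>) \<sigma> \<le> 1"
      unfolding cform_val_simps using cINF_lower[OF bdd[OF \<sigma>] a] F(2)[OF \<sigma> a] by linarith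
  qed
  show "\<bar>cform_val (C_algebra X) (ex_cform K n \<psi>) \<sigma> - cform_val (C_algebra X) (ex_cform K n \<psi>) \<tau>\<bar> \<le> L * d"
    if *: "ball_assignment X \<sigma>" "ball_assignment X \<tau>" "0 \<le> d"
        "\<And>x v. x \<in> topspace X \<Longrightarrow> cmod (\<sigma> v x - \<tau> v x) \<le> d" for \<sigma> \<tau> d
  proof -
    have "\<bar>?F (\<sigma>(n := a)) - ?F (\<tau>(n := a))\<bar> \<le> L * d" if a: "a \<in> ?B" for a
    proof -
      have same_defect: "?N (\<sigma>(n := a)) = ?N (\<tau>(n := a))" by (simp add: nrm_poly_val)
      have min_close: "\<bar>min 1 (p + r) - min 1 (q + r)\<bar> \<le> \<bar>p - q\<bar>" for p q r :: real by linarith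
      have "\<bar>cform_val (C_algebra X) \<psi> (\<sigma>(n := a)) - cform_val (C_algebra X) \<psi> (\<tau>(n := a))\<bar> \<le> L * d"
        using * by (intro expressesD(3)[OF \<psi>] ball_assignment_upd a) auto
      then show ?thesis unfolding same_defect by (rule order_trans[OF min_close])
    qed
    then show ?thesis unfolding cform_val_simps
      by (intro INF_close ne bdd *) blast+
  qed
  show "cform_val (C_algebra X) (ex_cform K n \<psi>) (projections X \<sigma>) =
      (if fo_sat (CL_algebra X) (FEx n \<phi>) \<sigma> then 0 else 1)"
    if \<sigma>: "\<forall>v. clopenin X (\<sigma> v)" for \<sigma>
  proof -
    have ball: "ball_assignment X (projections X \<sigma>)" using X \<sigma> by (rule ball_assignment_projections)
    have upd: "(projections X \<sigma>)(n := projection X U) = projections X (\<sigma>(n := U))" for U by auto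
    have val: "cform_val (C_algebra X) \<psi> ((projections X \<sigma>)(n := projection X U)) =
      (if fo_sat (CL_algebra X) \<phi> (\<sigma>(n := U)) then 0 else 1)" if "clopenin X U" for U
      unfolding upd using \<sigma> that by (intro expressesD(4)[OF \<psi>]) simp
    show ?thesis
    proof (cases "fo_sat (CL_algebra X) (FEx n \<phi>) \<sigma>")
      case True
      then obtain U where U: "clopenin X U" "fo_sat (CL_algebra X) \<phi> (\<sigma>(n := U))"
        by (auto simp: carrier_CL_algebra)
      have "?N ((projections X \<sigma>)(n := projection X U)) = 0"
        by (intro nrm_poly_val_eq_0) (simp add: projection_def)
      then have "?F ((projections X \<sigma>)(n := projection X U)) = 0"
        using val[OF U(1)] U(2) by simp
      then have "cform_val (C_algebra X) (ex_cform K n \<psi>) (projections X \<sigma>) \<le> 0"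
        unfolding cform_val_simps
        using cINF_lower[OF bdd[OF ball] projection_mem_closed_unit_ball[OF X U(1)]] by linarith
      then show ?thesis using range[OF ball] True by simp
    next
      case False
      have "?F ((projections X \<sigma>)(n := a)) = 1" if a: "a \<in> ?B" for a
      proof -
        let ?\<sigma> = "(projections X \<sigma>)(n := a)"
        define d where "d = ?N ?\<sigma>"
        have ball': "ball_assignment X ?\<sigma>" using ball a by (rule ball_assignment_upd)
        have "0 \<le> d" unfolding d_def using X ball' by (rule nrm_poly_val_nonneg)
        have "1 \<le> cform_val (C_algebra X) \<psi> ?\<sigma> + K * d"
        proof (cases "d < 1 / 8")
          case True
          obtain U where U: "clopenin X U" "\<forall>x\<in>topspace X. cmod (?\<sigma> n x - projection X U x) \<le> 2 * d"
            using projection_near_almost_idempotent[OF X ball' d_def True] by blast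
          have "\<bar>cform_val (C_algebra X) \<psi> ?\<sigma> -
              cform_val (C_algebra X) \<psi> ((projections X \<sigma>)(n := projection X U))\<bar> \<le> L * (2 * d)"
            using U(2) \<open>0 \<le> d\<close>
            by (intro expressesD(3)[OF \<psi> ball'] ball_assignment_upd ball
                projection_mem_closed_unit_ball X U) auto
          moreover have "cform_val (C_algebra X) \<psi> ((projections X \<sigma>)(n := projection X U)) = 1"
            using val[OF U(1)] False U(1) by (simp add: carrier_CL_algebra)
          moreover have "L * (2 * d) \<le> K * d" using \<open>0 \<le> d\<close> by (simp add: K algebra_simps)
          ultimately show ?thesis by linarith
        next
          case False
          then have "1 \<le> 8 * d" by simp
          also have "\<dots> \<le> K * d" using \<open>0 \<le> d\<close> L by (intro mult_right_mono) (auto simp: K)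
          finally show ?thesis using expressesD(1)[OF \<psi> ball'] by linarith
        qed
        then show ?thesis unfolding d_def by simp
      qed
      then have "cform_val (C_algebra X) (ex_cform K n \<psi>) (projections X \<sigma>) = (INF a\<in>?B. 1)"
        unfolding cform_val_simps by (intro INF_cong refl)
      then show ?thesis using False ne by simp
    qed
  qed
qed

text \<open>A single continuous formula must serve both spaces. Disjunctions and universal quantifiers are
  reduced to the other connectives by duality.\<close>

lemma first_order_formula_expressible:
  assumes X: "compact_space X" and Y: "compact_space Y"
  shows "\<exists>\<psi> L. wf_cform \<psi> \<and> cform_vars \<psi> \<subseteq> fo_vars \<phi> \<and> 0 \<le> L \<and> expresses X L \<phi> \<psi> \<and> expresses Y L \<phi> \<psi>"
proof (induction \<phi>)
  case (FEq s t)
  obtain L where "L \<ge> 0" "\<And>z w d. \<forall>v. cmod (z v) \<le> 1 \<Longrightarrow> \<forall>v. cmod (w v) \<le> 1 \<Longrightarrow> \<forall>v. cmod (z v - w v) \<le> d \<Longrightarrow>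
      cmod (poly_eval (PDiff (term_poly s) (term_poly t)) z -
          poly_eval (PDiff (term_poly s) (term_poly t)) w) \<le> L * d"
    using poly_eval_lipschitz[of "PDiff (term_poly s) (term_poly t)"] by metis
  then have "expresses X L (FEq s t) (eq_cform s t)" "expresses Y L (FEq s t) (eq_cform s t)"
    using expresses_eq X Y by blast+
  then show ?case
    using \<open>L \<ge> 0\<close> by (intro exI[of _ "eq_cform s t"] exI[of _ L]) (simp add: wf_cform_simps cform_vars_simps)
next
  case (FNot \<phi>)
  then obtain \<psi> L where "wf_cform \<psi>" "cform_vars \<psi> \<subseteq> fo_vars \<phi>" "0 \<le> L" "expresses X L \<phi> \<psi>" "expresses Y L \<phi> \<psi>"
    by blast
  then show ?case
    by (intro exI[of _ "not_cform \<psi>"] exI[of _ L]) (simp add: wf_cform_simps cform_vars_simps expresses_not)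
next
  case (FAnd \<phi> \<phi>')
  obtain \<psi> L where 1: "wf_cform \<psi>" "cform_vars \<psi> \<subseteq> fo_vars \<phi>" "0 \<le> L" "expresses X L \<phi> \<psi>" "expresses Y L \<phi> \<psi>"
    using FAnd.IH(1) by blast
  obtain \<psi>' L' where 2: "wf_cform \<psi>'" "cform_vars \<psi>' \<subseteq> fo_vars \<phi>'" "0 \<le> L'" "expresses X L' \<phi>' \<psi>'"
      "expresses Y L' \<phi>' \<psi>'"
    using FAnd.IH(2) by blast
  have "expresses X (max L L') (FAnd \<phi> \<phi>') (and_cform \<psi> \<psi>')"
      "expresses Y (max L L') (FAnd \<phi> \<phi>') (and_cform \<psi> \<psi>')"
    by (intro expresses_and expresses_mono[OF 1(4)] expresses_mono[OF 2(4)] expresses_mono[OF 1(5)]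
        expresses_mono[OF 2(5)]; simp)+
  then show ?case using 1 2
    by (intro exI[of _ "and_cform \<psi> \<psi>'"] exI[of _ "max L L'"]) (auto simp: wf_cform_simps cform_vars_simps)
next
  case (FOr \<phi> \<phi>')
  obtain \<psi> L where 1: "wf_cform \<psi>" "cform_vars \<psi> \<subseteq> fo_vars \<phi>" "0 \<le> L" "expresses X L \<phi> \<psi>" "expresses Y L \<phi> \<psi>"
    using FOr.IH(1) by blast
  obtain \<psi>' L' where 2: "wf_cform \<psi>'" "cform_vars \<psi>' \<subseteq> fo_vars \<phi>'" "0 \<le> L'" "expresses X L' \<phi>' \<psi>'"
      "expresses Y L' \<phi>' \<psi>'"
    using FOr.IH(2) by blast
  let ?\<psi> = "not_cform (and_cform (not_cform \<psi>) (not_cform \<psi>'))"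
  have "expresses X (max L L') (FNot (FAnd (FNot \<phi>) (FNot \<phi>'))) ?\<psi>"
      "expresses Y (max L L') (FNot (FAnd (FNot \<phi>) (FNot \<phi>'))) ?\<psi>"
    by (intro expresses_not expresses_and expresses_mono[OF 1(4)] expresses_mono[OF 2(4)]
        expresses_mono[OF 1(5)] expresses_mono[OF 2(5)]; simp)+
  note 3 = this
  have "expresses X (max L L') (FOr \<phi> \<phi>') ?\<psi>" "expresses Y (max L L') (FOr \<phi> \<phi>') ?\<psi>"
    by (rule expresses_cong[OF 3(1)], simp) (rule expresses_cong[OF 3(2)], simp)
  then show ?case using 1 2
    by (intro exI[of _ ?\<psi>] exI[of _ "max L L'"]) (auto simp: wf_cform_simps cform_vars_simps)
next
  case (FAll n \<phi>)
  then obtain \<psi> L where 1: "wf_cform \<psi>" "cform_vars \<psi> \<subseteq> fo_vars \<phi>" "0 \<le> L" "expresses X L \<phi> \<psi>"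
      "expresses Y L \<phi> \<psi>"
    by blast
  let ?\<psi> = "not_cform (ex_cform (2 * L + 8) n (not_cform \<psi>))"
  have "expresses X L (FNot (FEx n (FNot \<phi>))) ?\<psi>" "expresses Y L (FNot (FEx n (FNot \<phi>))) ?\<psi>"
    using 1 by (auto intro!: expresses_not expresses_ex X Y)
  note 3 = this
  have "expresses X L (FAll n \<phi>) ?\<psi>" "expresses Y L (FAll n \<phi>) ?\<psi>"
    by (rule expresses_cong[OF 3(1)], simp) (rule expresses_cong[OF 3(2)], simp)
  then show ?case using 1
    by (intro exI[of _ ?\<psi>] exI[of _ L]) (auto simp: wf_cform_simps cform_vars_simps)
next
  case (FEx n \<phi>)
  then obtain \<psi> L where 1: "wf_cform \<psi>" "cform_vars \<psi> \<subseteq> fo_vars \<phi>" "0 \<le> L" "expresses X L \<phi> \<psi>"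
      "expresses Y L \<phi> \<psi>"
    by blast
  then show ?case
    by (intro exI[of _ "ex_cform (2 * L + 8) n \<psi>"] exI[of _ L])
      (auto simp: wf_cform_simps cform_vars_simps intro!: expresses_ex X Y)
qed

lemma csentence_val_eq_0_iff:
  assumes "expresses X L \<phi> \<psi>"
  shows "csentence_val (C_algebra X) \<psi> = 0 \<longleftrightarrow> fo_models (CL_algebra X) \<phi>"
proof -
  have "ba_bot (CL_algebra X) = {}" by (simp add: CL_algebra_def)
  then show ?thesis
    using expressesD(4)[OF assms, of "\<lambda>_. {}"]
    by (simp add: csentence_val_def fo_models_def projection_empty)
qed

lemma metric_elementarily_equivalent_imp_elementarily_equivalent:
  assumes X: "compact_space X" and Y: "compact_space Y"
    and "metric_elementarily_equivalent (C_algebra X) (C_algebra Y)"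
  shows "elementarily_equivalent (CL_algebra X) (CL_algebra Y)"
  unfolding elementarily_equivalent_def
proof (intro allI impI)
  fix \<phi> assume "fo_sentence \<phi>"
  obtain \<psi> L where \<psi>: "wf_cform \<psi>" "cform_vars \<psi> \<subseteq> fo_vars \<phi>" "expresses X L \<phi> \<psi>" "expresses Y L \<phi> \<psi>"
    using first_order_formula_expressible[OF X Y] by blast
  have "csentence \<psi>" using \<psi>(1,2) \<open>fo_sentence \<phi>\<close> by (simp add: csentence_def fo_sentence_def)
  then show "fo_models (CL_algebra X) \<phi> \<longleftrightarrow> fo_models (CL_algebra Y) \<phi>"
    using assms(3) csentence_val_eq_0_iff[OF \<psi>(3)] csentence_val_eq_0_iff[OF \<psi>(4)]
    unfolding metric_elementarily_equivalent_def by blast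
qed

section \<open>The characterization of elementary equivalence\<close>

theorem theorem1p3:
  fixes X :: "'a topology" and Y :: "'b topology"
  assumes "compact_space X" and "Hausdorff_space X" and "zero_dimensional X"
    and "compact_space Y" and "Hausdorff_space Y" and "zero_dimensional Y"
  shows "metric_elementarily_equivalent (C_algebra X) (C_algebra Y) \<longleftrightarrow>
         elementarily_equivalent (CL_algebra X) (CL_algebra Y)"
proof
  assume "metric_elementarily_equivalent (C_algebra X) (C_algebra Y)"
  then show "elementarily_equivalent (CL_algebra X) (CL_algebra Y)"
    using assms metric_elementarily_equivalent_imp_elementarily_equivalent by blast
next
  assume "elementarily_equivalent (CL_algebra X) (CL_algebra Y)"
  then have "split_equiv X Y n (topspace X) (topspace Y)" for n
    by (rule elementarily_equivalent_imp_split_equiv)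
  then show "metric_elementarily_equivalent (C_algebra X) (C_algebra Y)"
    using assms split_equiv_imp_metric_elementarily_equivalent by blast
qed

end
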